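(* Let $(\mathcal{A},\alpha)$ be a unital Krein $C^*$-algebra, $\mathcal{X}$ a full Hilbert $\mathcal{A}$-module, $\mathcal{G}$ a locally compact group and $\eta$ an action of $\mathcal{G}$ on $\mathcal{X}$. Let $(\mathcal{H}_1,J_1)$ and $(\mathcal{H}_2,J_2=\mathrm{id}_{\mathcal{H}_2})$ be Krein spaces, let $u$ be a simultaneously unitary and pseudo-unitary representation of $\mathcal{G}$ on $(\mathcal{H}_1,J_1)$ and $u'$ a pseudo-unitary representation of $\mathcal{G}$ on $(\mathcal{H}_2,J_2)$. Let $\varphi:\mathcal{A}\to\mathcal{L}(\mathcal{H}_1)$ be an $\alpha$-completely positive map and $\Phi:\mathcal{X}\to\mathcal{L}(\mathcal{H}_1,\mathcal{H}_2)$ a $\varphi$-map which is $(u',u)$-covariant with respect to $\eta$. Then there are two Krein spaces $(\mathcal{K}_1,J_3)$ and $(\mathcal{K}_2,J_4)$, two pseudo-unitary representations $v$ and $v'$ of $\mathcal{G}$ on $(\mathcal{K}_1,J_3)$ and $(\mathcal{K}_2,J_4)$ respectively, a representation $\pi_\varphi$ of $\mathcal{A}$ on $(\mathcal{K}_1,J_3)$, a $\pi_\varphi$-representation $\pi_{\mathcal{X}}$ of $\mathcal{X}$ on $(\mathcal{K}_1,J_3)$ and $(\mathcal{K}_2,J_4)$ which is $(v',v)$-covariant with respect to $\eta$, and two operators $V_\Phi:\mathcal{H}_1\to\mathcal{K}_1$ and $W_\Phi:\mathcal{H}_2\to\mathcal{K}_2$ such that: (1) $V_\Phi^{\#}=V_\Phi^*$,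 $\pi_\varphi(\alpha(a))V_\Phi=J_3\pi_\varphi(a)V_\Phi J_1$ for all $a\in\mathcal{A}$, and $W_\Phi$ is a coisometry with $W_\Phi^{\#}=W_\Phi^*$; (2) $\varphi(a)=V_\Phi^{\#}\pi_\varphi(a)V_\Phi$ for all $a\in\mathcal{A}$; (3) $\Phi(x)=W_\Phi^{\#}\pi_{\mathcal{X}}(x)V_\Phi$ for all $x\in\mathcal{X}$; (4) $v_t^{\#}=v_t^*$ and $(v'_t)^{\#}=(v'_t)^*$ for all $t\in\mathcal{G}$; (5) $V_\Phi u_t=v_tV_\Phi$ and $W_\Phi u'_t=v'_tW_\Phi$ for all $t\in\mathcal{G}$.
   Context: Maps and operators are bounded and linear; inner products are linear in the second variable; $\mathcal{L}(\cdot,\cdot)$ denotes bounded operators between Hilbert spaces. A coisometry is $W$ with $WW^*=\mathrm{id}$. Krein $C^*$-algebra: a pair $(\mathcal{A},\alpha)$ with $\mathcal{A}$ a $C^*$-algebra and $\alpha$ a $*$-automorphism of $\mathcal{A}$ with $\alpha^2=\mathrm{id}$; put $a^{\#}=\alpha(a^* )$. Krein space: a pair $(\mathcal{H},J)$ with $\mathcal{H}$ a complex Hilbert space and $J\in\mathcal{L}(\mathcal{H})$, $J=J^*=J^{-1}$. For Krein spaces $(\mathcal{H},J)$, $(\mathcal{H}',J')$ and $T\in\mathcal{L}(\mathcal{H},\mathcal{H}')$ put $T^{\#}=JT^*J'\in\mathcal{L}(\mathcal{H}',\mathcal{H})$. $\alpha$-completely positive ($\alpha$-CP) map of $\mathcal{A}$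 on $(\mathcal{H},J)$: a map $\varphi:\mathcal{A}\to\mathcal{L}(\mathcal{H})$ with $\varphi(a^* )=\varphi(a)^*$ such that (i) $\varphi(\alpha(a))=J\varphi(a)J=\varphi(a)$ for all $a$; (ii) the matrix $[\varphi(a_i^{\#}a_j)]_{i,j=1}^n$ is positive for all $n\ge1$ and $a_1,\dots,a_n\in\mathcal{A}$; (iii) for every $a\in\mathcal{A}$ there is $M(a)>0$ with $[\varphi((aa_i)^{\#}aa_j)]_{i,j=1}^n\le M(a)[\varphi(a_i^{\#}a_j)]_{i,j=1}^n$ for all $n\ge1$ and $a_1,\dots,a_n\in\mathcal{A}$. $\varphi$-map: a map $\Phi:\mathcal{X}\to\mathcal{L}(\mathcal{H}_1,\mathcal{H}_2)$ with $\Phi(x)^{\#}\Phi(y)=\varphi(\langle x,y\rangle)$ for all $x,y\in\mathcal{X}$. Representation of $\mathcal{A}$ on $(\mathcal{K},J)$: a homomorphism $\pi:\mathcal{A}\to\mathcal{L}(\mathcal{K})$ with $\pi(a^* )=J\pi(a)^*J=\pi(a)^{\#}$. $\pi_{\mathcal{A}}$-representation of $\mathcal{X}$ on $(\mathcal{K}_1,J_3)$, $(\mathcal{K}_2,J_4)$, where $\pi_{\mathcal{A}}$ is a representation of $\mathcal{A}$ on $(\mathcal{K}_1,J_3)$: a map $\pi_{\mathcal{X}}:\mathcal{X}\to\mathcal{L}(\mathcal{K}_1,\mathcal{K}_2)$ with $\pi_{\mathcal{X}}(x)^{\#}\pi_{\mathcal{X}}(y)=\pi_{\mathcal{A}}(\langle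 x,y\rangle)$ for all $x,y$. Action of $\mathcal{G}$ on the full Hilbert $\mathcal{A}$-module $\mathcal{X}$: a group morphism $t\mapsto\eta_t$ from $\mathcal{G}$ to the group of Hilbert $C^*$-module isomorphisms of $\mathcal{X}$ onto itself (bijective linear maps $\theta$ for which there is a $*$-automorphism $\beta$ of $\mathcal{A}$ with $\langle\theta x,\theta y\rangle=\beta(\langle x,y\rangle)$), such that $t\mapsto\eta_t(x)$ is continuous for each $x\in\mathcal{X}$. It induces a unique action $t\mapsto\beta_t^\eta$ of $\mathcal{G}$ on $\mathcal{A}$ with $\beta_t^\eta(\langle x,y\rangle)=\langle\eta_t(x),\eta_t(y)\rangle$. Pseudo-unitary representation of $\mathcal{G}$ on $(\mathcal{H},J)$: a map $t\mapsto u_t\in\mathcal{L}(\mathcal{H})$ with $u_e=\mathrm{id}$, $u_{ts}=u_tu_s$, $u_{t^{-1}}=u_t^{\#}$. It is simultaneously unitary and pseudo-unitary if moreover every $u_t$ is unitary, so that $u_t^*=u_t^{\#}$, equivalently $J u_t=u_tJ$. A $\varphi$-map $\Phi$ is $(u',u)$-covariant with respect to $\eta$ if $\Phi(\eta_t(x))=u'_t\Phi(x)u_t^{\#}$ for all $t\in\mathcal{G}$, $x\in\mathcal{X}$, and $\beta_t^\eta\circ\alpha=\alpha\circ\beta_t^\eta$ for all $t\in\mathcal{G}$. A representation $\pi_{\mathcal{X}}$ of $\mathcal{X}$ is $(v',v)$-covariant with respect to $\eta$ if $\pi_{\mathcal{X}}(\eta_t(x))=v'_t\pi_{\mathcal{X}}(x)v_t^{\#}$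 for all $t\in\mathcal{G}$, $x\in\mathcal{X}$. *)

theory Defs
  imports "HOL-Analysis.Analysis" "HOL-Algebra.Module"
begin

section \<open>Unital Krein C*-algebras\<close>

class scaleC =
  fixes scaleC :: "complex \<Rightarrow> 'a \<Rightarrow> 'a" (infixr \<open>*\<^sub>C\<close> 75)

class complex_vector = real_vector + scaleC +
  assumes scaleC_add_right: "c *\<^sub>C (x + y) = c *\<^sub>C x + c *\<^sub>C y"
    and scaleC_add_left: "(c + d) *\<^sub>C x = c *\<^sub>C x + d *\<^sub>C x"
    and scaleC_scaleC: "c *\<^sub>C (d *\<^sub>C x) = (c * d) *\<^sub>C x"
    and scaleC_one: "1 *\<^sub>C x = x"
    and scaleR_scaleC: "r *\<^sub>R x = complex_of_real r *\<^sub>C x"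

class complex_normed_vector = complex_vector + real_normed_vector +
  assumes norm_scaleC: "norm (c *\<^sub>C x) = cmod c * norm x"

class cstar_algebra = complex_normed_vector + real_normed_algebra + banach +
  fixes star :: "'a \<Rightarrow> 'a"
  assumes mult_scaleC_left: "(c *\<^sub>C x) * y = c *\<^sub>C (x * y)"
    and mult_scaleC_right: "x * (c *\<^sub>C y) = c *\<^sub>C (x * y)"
    and star_star: "star (star x) = x"
    and star_add: "star (x + y) = star x + star y"
    and star_scaleC: "star (c *\<^sub>C x) = cnj c *\<^sub>C star x"
    and star_mult: "star (x * y) = star y * star x"
    and cstar_identity: "norm (star x * x) = (norm x)\<^sup>2"

text \<open>The unit comes from \<^class>\<open>monoid_mult\<close> and not from \<^class>\<open>ring_1\<close>, which would
  exclude the zero algebra.\<close>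

class unital_cstar_algebra = cstar_algebra + monoid_mult

definition star_automorphism :: "('a::cstar_algebra \<Rightarrow> 'a) \<Rightarrow> bool" where
  "star_automorphism \<alpha> \<longleftrightarrow> bij \<alpha> \<and>
     (\<forall>x y. \<alpha> (x + y) = \<alpha> x + \<alpha> y) \<and> (\<forall>c x. \<alpha> (c *\<^sub>C x) = c *\<^sub>C \<alpha> x) \<and>
     (\<forall>x y. \<alpha> (x * y) = \<alpha> x * \<alpha> y) \<and> (\<forall>x. \<alpha> (star x) = star (\<alpha> x))"

definition krein_cstar_algebra :: "('a::cstar_algebra \<Rightarrow> 'a) \<Rightarrow> bool" where
  "krein_cstar_algebra \<alpha> \<longleftrightarrow> star_automorphism \<alpha> \<and> (\<forall>x. \<alpha> (\<alpha> x) = x)"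

definition sharp :: "('a::cstar_algebra \<Rightarrow> 'a) \<Rightarrow> 'a \<Rightarrow> 'a" where
  "sharp \<alpha> x = \<alpha> (star x)"

definition cstar_positive :: "'a::cstar_algebra \<Rightarrow> bool" where
  "cstar_positive x \<longleftrightarrow> (\<exists>y. x = star y * y)"


section \<open>Hilbert C*-modules\<close>

text \<open>The norm of the type \<^typ>\<open>'x\<close> is the Hilbert module norm, and completeness with respect to
  it is the sort \<^class>\<open>banach\<close>.\<close>

locale hilbert_cstar_module =
  fixes act :: "'x::{complex_normed_vector, banach} \<Rightarrow> 'a::cstar_algebra \<Rightarrow> 'x"
    and ip :: "'x \<Rightarrow> 'x \<Rightarrow> 'a"
  assumes act_add_left: "act (x + y) a = act x a + act y a"
    and act_add_right: "act x (a + b) = act x a + act x b"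
    and act_mult: "act x (a * b) = act (act x a) b"
    and act_scaleC_left: "act (c *\<^sub>C x) a = c *\<^sub>C act x a"
    and act_scaleC_right: "act x (c *\<^sub>C a) = c *\<^sub>C act x a"
    and ip_add_right: "ip x (y + z) = ip x y + ip x z"
    and ip_scaleC_right: "ip x (c *\<^sub>C y) = c *\<^sub>C ip x y"
    and ip_act_right: "ip x (act y a) = ip x y * a"
    and ip_star: "star (ip x y) = ip y x"
    and ip_positive: "cstar_positive (ip x x)"
    and ip_definite: "ip x x = 0 \<Longrightarrow> x = 0"
    and norm_ip: "norm x = sqrt (norm (ip x x))"

definition full_ip :: "('x \<Rightarrow> 'x \<Rightarrow> 'a::cstar_algebra) \<Rightarrow> bool" where
  "full_ip ip \<longleftrightarrow> closure (module.span scaleC {ip x y |x y. True}) = UNIV"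

definition hilbert_module_iso ::
  "('x::complex_normed_vector \<Rightarrow> 'x \<Rightarrow> 'a::cstar_algebra) \<Rightarrow> ('x \<Rightarrow> 'x) \<Rightarrow> bool" where
  "hilbert_module_iso ip \<theta> \<longleftrightarrow> bij \<theta> \<and>
     (\<forall>x y. \<theta> (x + y) = \<theta> x + \<theta> y) \<and> (\<forall>c x. \<theta> (c *\<^sub>C x) = c *\<^sub>C \<theta> x) \<and>
     (\<exists>\<beta>. star_automorphism \<beta> \<and> (\<forall>x y. ip (\<theta> x) (\<theta> y) = \<beta> (ip x y)))"


section \<open>Locally compact groups and their actions\<close>

text \<open>The Hausdorff property is not required; groups that have it are of course covered.\<close>

definition locally_compact_group :: "('g, 'm) monoid_scheme \<Rightarrow> 'g topology \<Rightarrow> bool" where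
  "locally_compact_group G T \<longleftrightarrow> Group.group G \<and> topspace T = carrier G \<and>
     continuous_map (prod_topology T T) T (\<lambda>(s, t). s \<otimes>\<^bsub>G\<^esub> t) \<and>
     continuous_map T T (\<lambda>t. inv\<^bsub>G\<^esub> t) \<and>
     locally_compact_space T"

definition module_action ::
  "('g, 'm) monoid_scheme \<Rightarrow> 'g topology \<Rightarrow> ('x::complex_normed_vector \<Rightarrow> 'x \<Rightarrow> 'a::cstar_algebra)
    \<Rightarrow> ('g \<Rightarrow> 'x \<Rightarrow> 'x) \<Rightarrow> bool" where
  "module_action G T ip \<eta> \<longleftrightarrow>
     (\<forall>t\<in>carrier G. hilbert_module_iso ip (\<eta> t)) \<and>
     (\<forall>s\<in>carrier G. \<forall>t\<in>carrier G. \<eta> (s \<otimes>\<^bsub>G\<^esub> t) = \<eta> s \<circ> \<eta> t) \<and>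
     (\<forall>x. continuous_map T euclidean (\<lambda>t. \<eta> t x))"

text \<open>For full modules the automorphism described here exists and is unique.\<close>

definition induced_action ::
  "('x \<Rightarrow> 'x \<Rightarrow> 'a::cstar_algebra) \<Rightarrow> ('g \<Rightarrow> 'x \<Rightarrow> 'x) \<Rightarrow> 'g \<Rightarrow> 'a \<Rightarrow> 'a" where
  "induced_action ip \<eta> t =
     (THE \<beta>. star_automorphism \<beta> \<and> (\<forall>x y. \<beta> (ip x y) = ip (\<eta> t x) (\<eta> t y)))"


section \<open>Hilbert spaces and Krein spaces with explicit carriers\<close>

text \<open>A Hilbert space is a module over the field of complex numbers with an inner product; the
  fields for multiplication and unit inherited from rings play no role. All conditions on vectors
  and operators refer to carriers only, and operators are compared on the carrier of their
  domain.\<close>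

definition complex_ring :: "complex ring" where
  "complex_ring = \<lparr>carrier = UNIV, mult = (*), one = 1, zero = 0, add = (+)\<rparr>"

record 'h hilbert = "(complex, 'h) module" +
  cinner :: "'h \<Rightarrow> 'h \<Rightarrow> complex"

record 'h krein = "'h hilbert" +
  fsym :: "'h \<Rightarrow> 'h"

definition hnorm :: "('h, 'm) hilbert_scheme \<Rightarrow> 'h \<Rightarrow> real" where
  "hnorm H x = sqrt (Re (cinner H x x))"

locale hilbert_space = Module.module complex_ring H
  for H :: "('h, 'm) hilbert_scheme" (structure) +
  assumes cinner_add_right: "\<lbrakk>x \<in> carrier H; y \<in> carrier H; z \<in> carrier H\<rbrakk> \<Longrightarrow>
        cinner H x (y \<oplus> z) = cinner H x y + cinner H x z"
    and cinner_smult_right: "\<lbrakk>x \<in> carrier H; y \<in> carrier H\<rbrakk> \<Longrightarrow>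
        cinner H x (c \<odot> y) = c * cinner H x y"
    and cinner_commute: "\<lbrakk>x \<in> carrier H; y \<in> carrier H\<rbrakk> \<Longrightarrow>
        cinner H y x = cnj (cinner H x y)"
    and cinner_positive: "x \<in> carrier H \<Longrightarrow> 0 \<le> Re (cinner H x x)"
    and cinner_definite: "\<lbrakk>x \<in> carrier H; cinner H x x = 0\<rbrakk> \<Longrightarrow> x = \<zero>"
    and complete: "\<lbrakk>\<And>n::nat. \<sigma> n \<in> carrier H;
        \<And>\<epsilon>. \<epsilon> > 0 \<Longrightarrow> \<exists>N. \<forall>m\<ge>N. \<forall>n\<ge>N. hnorm H (\<sigma> m \<ominus> \<sigma> n) < \<epsilon>\<rbrakk> \<Longrightarrow>
        \<exists>x\<in>carrier H. (\<lambda>n. hnorm H (\<sigma> n \<ominus> x)) \<longlonglongrightarrow> 0"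

definition bounded_ops ::
  "('h, 'm) hilbert_scheme \<Rightarrow> ('k, 'n) hilbert_scheme \<Rightarrow> ('h \<Rightarrow> 'k) set" where
  "bounded_ops H K = {T \<in> carrier H \<rightarrow> carrier K.
     (\<forall>x\<in>carrier H. \<forall>y\<in>carrier H. T (x \<oplus>\<^bsub>H\<^esub> y) = T x \<oplus>\<^bsub>K\<^esub> T y) \<and>
     (\<forall>c. \<forall>x\<in>carrier H. T (c \<odot>\<^bsub>H\<^esub> x) = c \<odot>\<^bsub>K\<^esub> T x) \<and>
     (\<exists>C. \<forall>x\<in>carrier H. hnorm K (T x) \<le> C * hnorm H x)}"

definition hadj ::
  "('h, 'm) hilbert_scheme \<Rightarrow> ('k, 'n) hilbert_scheme \<Rightarrow> ('h \<Rightarrow> 'k) \<Rightarrow> 'k \<Rightarrow> 'h" where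
  "hadj H K T y =
     (THE x. x \<in> carrier H \<and> (\<forall>z\<in>carrier H. cinner H x z = cinner K y (T z)))"

definition unitary_op :: "('h, 'm) hilbert_scheme \<Rightarrow> ('h \<Rightarrow> 'h) \<Rightarrow> bool" where
  "unitary_op H U \<longleftrightarrow> U \<in> bounded_ops H H \<and>
     (\<forall>x\<in>carrier H. hadj H H U (U x) = x \<and> U (hadj H H U x) = x)"

definition coisometry ::
  "('h, 'm) hilbert_scheme \<Rightarrow> ('k, 'n) hilbert_scheme \<Rightarrow> ('h \<Rightarrow> 'k) \<Rightarrow> bool" where
  "coisometry H K W \<longleftrightarrow> W \<in> bounded_ops H K \<and> (\<forall>y\<in>carrier K. W (hadj H K W y) = y)"

definition krein_space :: "('h, 'm) krein_scheme \<Rightarrow> bool" where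
  "krein_space H \<longleftrightarrow> hilbert_space H \<and> fsym H \<in> bounded_ops H H \<and>
     (\<forall>x\<in>carrier H. hadj H H (fsym H) x = fsym H x \<and> fsym H (fsym H x) = x)"

definition kadj ::
  "('h, 'm) krein_scheme \<Rightarrow> ('k, 'n) krein_scheme \<Rightarrow> ('h \<Rightarrow> 'k) \<Rightarrow> 'k \<Rightarrow> 'h" where
  "kadj H K T y = fsym H (hadj H K T (fsym K y))"

definition pseudo_unitary_rep ::
  "('g, 'l) monoid_scheme \<Rightarrow> ('h, 'm) krein_scheme \<Rightarrow> ('g \<Rightarrow> 'h \<Rightarrow> 'h) \<Rightarrow> bool" where
  "pseudo_unitary_rep G H u \<longleftrightarrow>
     (\<forall>t\<in>carrier G. u t \<in> bounded_ops H H) \<and>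
     (\<forall>x\<in>carrier H. u \<one>\<^bsub>G\<^esub> x = x) \<and>
     (\<forall>t\<in>carrier G. \<forall>s\<in>carrier G. \<forall>x\<in>carrier H. u (t \<otimes>\<^bsub>G\<^esub> s) x = u t (u s x)) \<and>
     (\<forall>t\<in>carrier G. \<forall>x\<in>carrier H. u (inv\<^bsub>G\<^esub> t) x = kadj H H (u t) x)"


section \<open>Completely positive maps, module maps and representations\<close>

definition bounded_linear_into_ops ::
  "('h, 'm) hilbert_scheme \<Rightarrow> ('k, 'n) hilbert_scheme \<Rightarrow>
    ('x::complex_normed_vector \<Rightarrow> 'h \<Rightarrow> 'k) \<Rightarrow> bool" where
  "bounded_linear_into_ops H K \<Phi> \<longleftrightarrow>
     (\<forall>x. \<Phi> x \<in> bounded_ops H K) \<and>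
     (\<forall>x y. \<forall>\<xi>\<in>carrier H. \<Phi> (x + y) \<xi> = \<Phi> x \<xi> \<oplus>\<^bsub>K\<^esub> \<Phi> y \<xi>) \<and>
     (\<forall>c x. \<forall>\<xi>\<in>carrier H. \<Phi> (c *\<^sub>C x) \<xi> = c \<odot>\<^bsub>K\<^esub> \<Phi> x \<xi>) \<and>
     (\<exists>C. \<forall>x. \<forall>\<xi>\<in>carrier H. hnorm K (\<Phi> x \<xi>) \<le> C * norm x * hnorm H \<xi>)"

text \<open>An \<open>n \<times> n\<close> matrix \<open>T\<close> of operators on \<open>H\<close> acts on the Hilbert space direct sum of \<open>n\<close> copies
  of \<open>H\<close>; its value at \<open>\<xi> = (\<xi> 0, \<dots>, \<xi> (n - 1))\<close> paired with \<open>\<xi>\<close> is \<open>opmat_form H n T \<xi>\<close>.\<close>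

definition opmat_form ::
  "('h, 'm) hilbert_scheme \<Rightarrow> nat \<Rightarrow> (nat \<Rightarrow> nat \<Rightarrow> 'h \<Rightarrow> 'h) \<Rightarrow> (nat \<Rightarrow> 'h) \<Rightarrow> complex" where
  "opmat_form H n T \<xi> = (\<Sum>i<n. \<Sum>j<n. cinner H (\<xi> i) (T i j (\<xi> j)))"

definition opmat_positive ::
  "('h, 'm) hilbert_scheme \<Rightarrow> nat \<Rightarrow> (nat \<Rightarrow> nat \<Rightarrow> 'h \<Rightarrow> 'h) \<Rightarrow> bool" where
  "opmat_positive H n T \<longleftrightarrow>
     (\<forall>\<xi>. (\<forall>i<n. \<xi> i \<in> carrier H) \<longrightarrow> opmat_form H n T \<xi> \<in> \<real>\<^sub>\<ge>\<^sub>0)"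

definition opmat_le ::
  "('h, 'm) hilbert_scheme \<Rightarrow> nat \<Rightarrow> (nat \<Rightarrow> nat \<Rightarrow> 'h \<Rightarrow> 'h) \<Rightarrow> (nat \<Rightarrow> nat \<Rightarrow> 'h \<Rightarrow> 'h) \<Rightarrow> bool" where
  "opmat_le H n S T \<longleftrightarrow> opmat_positive H n (\<lambda>i j \<xi>. T i j \<xi> \<ominus>\<^bsub>H\<^esub> S i j \<xi>)"

definition alpha_cp ::
  "('a::cstar_algebra \<Rightarrow> 'a) \<Rightarrow> ('h, 'm) krein_scheme \<Rightarrow> ('a \<Rightarrow> 'h \<Rightarrow> 'h) \<Rightarrow> bool" where
  "alpha_cp \<alpha> H \<phi> \<longleftrightarrow>
     bounded_linear_into_ops H H \<phi> \<and>
     (\<forall>a. \<forall>\<xi>\<in>carrier H. \<phi> (star a) \<xi> = hadj H H (\<phi> a) \<xi>) \<and>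
     (\<forall>a. \<forall>\<xi>\<in>carrier H. \<phi> (\<alpha> a) \<xi> = fsym H (\<phi> a (fsym H \<xi>)) \<and>
        fsym H (\<phi> a (fsym H \<xi>)) = \<phi> a \<xi>) \<and>
     (\<forall>n\<ge>1. \<forall>a. opmat_positive H n (\<lambda>i j. \<phi> (sharp \<alpha> (a i) * a j))) \<and>
     (\<forall>b. \<exists>M>0. \<forall>n\<ge>1. \<forall>a.
        opmat_le H n (\<lambda>i j. \<phi> (sharp \<alpha> (b * a i) * (b * a j)))
          (\<lambda>i j \<xi>. complex_of_real M \<odot>\<^bsub>H\<^esub> \<phi> (sharp \<alpha> (a i) * a j) \<xi>))"

definition phi_map ::
  "('h, 'm) krein_scheme \<Rightarrow> ('k, 'n) krein_scheme \<Rightarrow>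
    ('x::complex_normed_vector \<Rightarrow> 'x \<Rightarrow> 'a::cstar_algebra) \<Rightarrow>
    ('a \<Rightarrow> 'h \<Rightarrow> 'h) \<Rightarrow> ('x \<Rightarrow> 'h \<Rightarrow> 'k) \<Rightarrow> bool" where
  "phi_map H K ip \<phi> \<Phi> \<longleftrightarrow> bounded_linear_into_ops H K \<Phi> \<and>
     (\<forall>x y. \<forall>\<xi>\<in>carrier H. kadj H K (\<Phi> x) (\<Phi> y \<xi>) = \<phi> (ip x y) \<xi>)"

definition krein_rep :: "('h, 'm) krein_scheme \<Rightarrow> ('a::cstar_algebra \<Rightarrow> 'h \<Rightarrow> 'h) \<Rightarrow> bool" where
  "krein_rep H \<pi> \<longleftrightarrow> bounded_linear_into_ops H H \<pi> \<and>
     (\<forall>a b. \<forall>\<xi>\<in>carrier H. \<pi> (a * b) \<xi> = \<pi> a (\<pi> b \<xi>)) \<and>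
     (\<forall>a. \<forall>\<xi>\<in>carrier H. \<pi> (star a) \<xi> = kadj H H (\<pi> a) \<xi>)"

definition module_rep ::
  "('h, 'm) krein_scheme \<Rightarrow> ('k, 'n) krein_scheme \<Rightarrow>
    ('x::complex_normed_vector \<Rightarrow> 'x \<Rightarrow> 'a::cstar_algebra) \<Rightarrow>
    ('a \<Rightarrow> 'h \<Rightarrow> 'h) \<Rightarrow> ('x \<Rightarrow> 'h \<Rightarrow> 'k) \<Rightarrow> bool" where
  "module_rep H K ip \<pi> \<pi>X \<longleftrightarrow> krein_rep H \<pi> \<and> bounded_linear_into_ops H K \<pi>X \<and>
     (\<forall>x y. \<forall>\<xi>\<in>carrier H. kadj H K (\<pi>X x) (\<pi>X y \<xi>) = \<pi> (ip x y) \<xi>)"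

definition covariant_rep ::
  "('g, 'l) monoid_scheme \<Rightarrow> ('h, 'm) krein_scheme \<Rightarrow> ('x \<Rightarrow> 'h \<Rightarrow> 'k) \<Rightarrow>
    ('g \<Rightarrow> 'x \<Rightarrow> 'x) \<Rightarrow> ('g \<Rightarrow> 'k \<Rightarrow> 'k) \<Rightarrow> ('g \<Rightarrow> 'h \<Rightarrow> 'h) \<Rightarrow> bool" where
  "covariant_rep G H \<Phi> \<eta> u' u \<longleftrightarrow>
     (\<forall>t\<in>carrier G. \<forall>x. \<forall>\<xi>\<in>carrier H. \<Phi> (\<eta> t x) \<xi> = u' t (\<Phi> x (kadj H H (u t) \<xi>)))"

definition covariant_phi_map ::
  "('g, 'l) monoid_scheme \<Rightarrow> ('h, 'm) krein_scheme \<Rightarrow> ('a::cstar_algebra \<Rightarrow> 'a) \<Rightarrow>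
    ('x \<Rightarrow> 'x \<Rightarrow> 'a) \<Rightarrow> ('x \<Rightarrow> 'h \<Rightarrow> 'k) \<Rightarrow>
    ('g \<Rightarrow> 'x \<Rightarrow> 'x) \<Rightarrow> ('g \<Rightarrow> 'k \<Rightarrow> 'k) \<Rightarrow> ('g \<Rightarrow> 'h \<Rightarrow> 'h) \<Rightarrow> bool" where
  "covariant_phi_map G H \<alpha> ip \<Phi> \<eta> u' u \<longleftrightarrow> covariant_rep G H \<Phi> \<eta> u' u \<and>
     (\<forall>t\<in>carrier G. induced_action ip \<eta> t \<circ> \<alpha> = \<alpha> \<circ> induced_action ip \<eta> t)"

end

theory Submission
  imports Defs
begin

text \<open>The space \<open>K\<^sub>1\<close> is the completion of the algebraic tensor product of \<open>A\<close> and \<open>H\<^sub>1\<close> for the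
semi-inner product \<open>\<langle>a \<otimes> \<xi>, b \<otimes> \<zeta>\<rangle> = \<langle>\<xi>, \<phi>(a# b) \<zeta>\<rangle>\<close> with \<open>a# = \<alpha>(a*)\<close>, as in the construction
of Stinespring. On elementary tensors the operators are

\<open>\<pi>(c)(a \<otimes> \<xi>) = c a \<otimes> \<xi>\<close>, \<open>J\<^sub>3(a \<otimes> \<xi>) = \<alpha>(a) \<otimes> J\<^sub>1 \<xi>\<close>, \<open>V \<xi> = 1 \<otimes> \<xi>\<close>, \<open>v\<^sub>t(a \<otimes> \<xi>) = \<beta>\<^sub>t(a) \<otimes> u\<^sub>t \<xi>\<close>,
\<open>\<pi>\<^sub>X(x)(a \<otimes> \<xi>) = \<Phi>(x a) \<xi>\<close>.

Since \<open>\<Phi>\<close> already takes its values in \<open>H\<^sub>2\<close>, whose symmetry is the identity, one takes \<open>K\<^sub>2 = H\<^sub>2\<close>,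
\<open>W = id\<close> and \<open>v' = u'\<close>; then \<open>\<pi>\<^sub>X(x) V \<xi> = \<Phi>(x 1) \<xi> = \<Phi>(x) \<xi>\<close>.

The completion is realised as the reproducing kernel Hilbert space of the kernel
\<open>k (a, \<xi>) (b, \<zeta>) = \<langle>\<xi>, \<phi>(a# b) \<zeta>\<rangle>\<close> on pairs: a vector \<open>f\<close> is the function \<open>(a, \<xi>) \<mapsto> \<langle>a \<otimes> \<xi>, f\<rangle>\<close>.
This makes the operators easy to define on the whole space, without extension by continuity.
If a map \<open>m\<close> of the index set has an adjoint \<open>m'\<close> with respect to the kernel
(\<open>k (m s) t = k s (m' t)\<close>), then \<open>f \<mapsto> f \<circ> m\<close> is the operator that sends \<open>e\<^sub>s\<close> to \<open>e\<^bsub>m' s\<^esub>\<close>, and its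
Hilbert space adjoint is \<open>f \<mapsto> f \<circ> m'\<close> (\<open>hadj_pull\<close>). All identities between operators become
identities between maps of pairs; \<open>\<pi>(c)\<close>, \<open>J\<^sub>3\<close> and \<open>v\<^sub>t\<close> arise in this way from \<open>a \<mapsto> c# a\<close>, from \<open>\<alpha>\<close>
with \<open>J\<^sub>1\<close>, and from \<open>\<beta>\<close> with \<open>u\<close> at the inverse of \<open>t\<close>. The operator \<open>\<pi>\<^sub>X(x)\<close> is the adjoint of
\<open>y \<mapsto> ((a, \<xi>) \<mapsto> \<langle>\<Phi>(x a) \<xi>, y\<rangle>)\<close>.

Three points need an argument. The bound \<open>\<parallel>\<pi>(a)\<parallel> \<le> C \<parallel>a\<parallel>\<close> is not part of complete positivity,
which bounds each \<open>\<pi>(a)\<close> separately; it follows from the uniform boundedness principle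
(\<open>lmult_form_bound\<close>). The induced automorphisms \<open>\<beta>\<^sub>t\<close> are handled purely algebraically: a full
module over a unital algebra has inner products whose linear span is the whole algebra
(\<open>full_module_induct\<close>), so identities such as \<open>\<phi>(\<beta>\<^sub>t(a)) u\<^sub>t = u\<^sub>t \<phi>(a)\<close> (\<open>phi_beta\<close>) can be checked
on \<open>a = \<langle>x, y\<rangle>\<close>. Finally, \<open>\<langle>\<Phi>(x a) \<xi>, \<Phi>(y b) \<zeta>\<rangle> = \<langle>a \<otimes> \<xi>, J\<^sub>3 \<pi>(\<langle>x, y\<rangle>) (b \<otimes> \<zeta>)\<rangle>\<close>
(\<open>cinner_Phi_tensor\<close>) gives at once the boundedness of \<open>\<pi>\<^sub>X(x)\<close> and the module relation
\<open>\<pi>\<^sub>X(x)# \<pi>\<^sub>X(y) = \<pi>(\<langle>x, y\<rangle>)\<close>; it rests on \<open>\<phi> \<circ> \<alpha> = \<phi>\<close> and on \<open>\<phi>(a)\<close> commuting with \<open>J\<^sub>1\<close>.\<close>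

section \<open>Riesz representation and adjoints\<close>

lemma complex_ring_simps [simp]:
  "carrier complex_ring = UNIV" "x \<otimes>\<^bsub>complex_ring\<^esub> y = x * y" "\<one>\<^bsub>complex_ring\<^esub> = 1"
  "\<zero>\<^bsub>complex_ring\<^esub> = 0" "x \<oplus>\<^bsub>complex_ring\<^esub> y = x + y"
  by (simp_all add: complex_ring_def)

lemma cring_complex_ring: "cring complex_ring"
proof (rule cringI)
  have "\<exists>y. y + x = 0" for x :: complex by (rule exI[of _ "- x"]) simp
  then show "abelian_group complex_ring" by (intro abelian_groupI) auto
  show "Group.comm_monoid complex_ring" by (intro comm_monoidI) auto
qed (simp add: distrib_right)

lemma a_inv_complex_ring [simp]: "\<ominus>\<^bsub>complex_ring\<^esub> x = - x"
proof -
  interpret cring complex_ring by (rule cring_complex_ring)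
  show ?thesis by (rule minus_equality) auto
qed

context hilbert_space
begin

lemma smult_carrier [simp]: "x \<in> carrier H \<Longrightarrow> c \<odot> x \<in> carrier H"
  using smult_closed[of c x] by simp

lemma minus_as_smult: "\<lbrakk>x \<in> carrier H; y \<in> carrier H\<rbrakk> \<Longrightarrow> x \<ominus> y = x \<oplus> (-1) \<odot> y"
  using smult_l_minus[of 1 y] smult_one[of y] by (simp add: a_minus_def)

lemma cinner_add_left:
  "\<lbrakk>x \<in> carrier H; y \<in> carrier H; z \<in> carrier H\<rbrakk> \<Longrightarrow>
    cinner H (x \<oplus> y) z = cinner H x z + cinner H y z"
  by (metis M.add.m_closed cinner_add_right cinner_commute complex_cnj_add)

lemma cinner_smult_left:
  "\<lbrakk>x \<in> carrier H; y \<in> carrier H\<rbrakk> \<Longrightarrow> cinner H (c \<odot> x) y = cnj c * cinner H x y"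
  by (metis smult_carrier cinner_commute cinner_smult_right complex_cnj_mult)

lemma cinner_zero_right [simp]: "x \<in> carrier H \<Longrightarrow> cinner H x \<zero> = 0"
  using cinner_smult_right[of x x 0] smult_l_null[of x] by simp

lemma cinner_zero_left [simp]: "x \<in> carrier H \<Longrightarrow> cinner H \<zero> x = 0"
  using cinner_smult_left[of x x 0] smult_l_null[of x] by simp

lemma cinner_minus_right:
  "\<lbrakk>x \<in> carrier H; y \<in> carrier H; z \<in> carrier H\<rbrakk> \<Longrightarrow>
    cinner H x (y \<ominus> z) = cinner H x y - cinner H x z"
  by (simp add: minus_as_smult cinner_add_right cinner_smult_right)

lemma cinner_minus_left:
  "\<lbrakk>x \<in> carrier H; y \<in> carrier H; z \<in> carrier H\<rbrakk> \<Longrightarrow>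
    cinner H (x \<ominus> y) z = cinner H x z - cinner H y z"
  by (simp add: minus_as_smult cinner_add_left cinner_smult_left)

lemmas cinner_simps = cinner_add_left cinner_add_right cinner_smult_left cinner_smult_right
  cinner_minus_left cinner_minus_right

lemma Im_cinner_self [simp]: "x \<in> carrier H \<Longrightarrow> Im (cinner H x x) = 0"
  using arg_cong[OF cinner_commute[of x x], of Im] by simp

lemma hnorm_nonneg [simp]: "x \<in> carrier H \<Longrightarrow> 0 \<le> hnorm H x"
  by (simp add: hnorm_def cinner_positive)

lemma hnorm_square: "x \<in> carrier H \<Longrightarrow> (hnorm H x)\<^sup>2 = Re (cinner H x x)"
  by (simp add: hnorm_def cinner_positive)

lemma cinner_self: "x \<in> carrier H \<Longrightarrow> cinner H x x = complex_of_real ((hnorm H x)\<^sup>2)"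
  by (simp add: hnorm_square complex_eq_iff)

lemma cinner_ext:
  assumes "x \<in> carrier H" "y \<in> carrier H" "\<And>z. z \<in> carrier H \<Longrightarrow> cinner H z x = cinner H z y"
  shows "x = y"
proof -
  have "cinner H (x \<ominus> y) (x \<ominus> y) = 0"
    using assms by (simp add: cinner_minus_right)
  then have "x \<ominus> y = \<zero>" using assms cinner_definite by blast
  then have "x \<oplus> \<ominus> y = \<zero>" by (simp add: a_minus_def)
  then have "\<ominus> (\<ominus> y) = x" using assms by (intro M.minus_equality) auto
  then show ?thesis using assms by simp
qed

lemma Cauchy_Schwarz:
  assumes "x \<in> carrier H" "y \<in> carrier H"
  shows "cmod (cinner H x y) \<le> hnorm H x * hnorm H y"
proof (cases "x = \<zero>")
  case True
  then show ?thesis using assms by simp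
next
  case False
  define c where "c = cinner H x y"
  define n where "n = (hnorm H x)\<^sup>2"
  have "cinner H x x \<noteq> 0" using False assms cinner_definite by blast
  then have n: "n > 0" using assms by (simp add: n_def cinner_self)
  define w where "w = complex_of_real n \<odot> y \<ominus> c \<odot> x"
  have w: "w \<in> carrier H" using assms by (simp add: w_def)
  have yx: "cinner H y x = cnj c" using cinner_commute assms c_def by blast
  have "cinner H w w = of_real n * (of_real n * of_real ((hnorm H y)\<^sup>2) - cnj c * c)"
    using assms cinner_self[of x] cinner_self[of y] unfolding w_def
    by (simp add: cinner_simps yx algebra_simps flip: c_def n_def)
  moreover have cc: "cnj c * c = of_real ((cmod c)\<^sup>2)"
    using complex_norm_square[of c] by (simp only: mult.commute)
  ultimately have "Re (cinner H w w) = n * (n * (hnorm H y)\<^sup>2 - (cmod c)\<^sup>2)"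
    by (metis Re_complex_of_real cc of_real_diff of_real_mult)
  then have "0 \<le> n * (n * (hnorm H y)\<^sup>2 - (cmod c)\<^sup>2)" using cinner_positive[OF w] by simp
  then have "(cmod c)\<^sup>2 \<le> n * (hnorm H y)\<^sup>2" using n by (simp add: zero_le_mult_iff)
  then have "(cmod c)\<^sup>2 \<le> (hnorm H x * hnorm H y)\<^sup>2" by (simp add: n_def power_mult_distrib)
  then have "cmod c \<le> hnorm H x * hnorm H y" by (rule power2_le_imp_le) (simp add: assms)
  then show ?thesis by (simp add: c_def)
qed


text \<open>The representing vector maximises \<open>2 Re f(x) - \<parallel>x\<parallel>\<^sup>2\<close>, a concave function that the bound on \<open>f\<close>
keeps below \<open>C\<^sup>2\<close>. By the parallelogram law a maximising sequence is Cauchy, and the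
first-order condition at its limit \<open>x\<^sub>0\<close> reads \<open>Re \<langle>x\<^sub>0, z\<rangle> = Re f(z)\<close> for all \<open>z\<close>.\<close>

lemma Riesz_representation:
  assumes f_add: "\<And>x y. \<lbrakk>x \<in> carrier H; y \<in> carrier H\<rbrakk> \<Longrightarrow> f (x \<oplus> y) = f x + f y"
    and f_smult: "\<And>c x. x \<in> carrier H \<Longrightarrow> f (c \<odot> x) = c * f x"
    and f_bound: "\<And>x. x \<in> carrier H \<Longrightarrow> cmod (f x) \<le> C * hnorm H x"
  shows "\<exists>x\<in>carrier H. \<forall>z\<in>carrier H. cinner H x z = f z"
proof -
  define val where "val x = 2 * Re (f x) - (hnorm H x)\<^sup>2" for x
  define m where "m = (SUP x\<in>carrier H. val x)"
  have "val x \<le> C\<^sup>2" if "x \<in> carrier H" for x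
  proof -
    have "Re (f x) \<le> C * hnorm H x"
      using f_bound[OF that] complex_Re_le_cmod[of "f x"] by linarith
    moreover have "0 \<le> (C - hnorm H x)\<^sup>2" by simp
    ultimately show ?thesis by (simp add: val_def power2_diff)
  qed
  then have bdd: "bdd_above (val ` carrier H)" by (intro bdd_aboveI2)
  have val_le: "val x \<le> m" if "x \<in> carrier H" for x
    unfolding m_def by (rule cSUP_upper[OF that bdd])
  have "\<exists>x\<in>carrier H. val x > m - 1 / real (Suc n)" for n
  proof -
    have "m - 1 / real (Suc n) < (SUP x\<in>carrier H. val x)" by (simp add: m_def)
    then show ?thesis using bdd by (subst (asm) less_cSUP_iff) auto
  qed
  then obtain \<sigma> where \<sigma>: "\<And>n. \<sigma> n \<in> carrier H" "\<And>n. val (\<sigma> n) > m - 1 / real (Suc n)"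
    by metis
  \<comment> \<open>The parallelogram law, with the midpoint of \<open>x\<close> and \<open>y\<close> as competitor.\<close>
  have dist: "(hnorm H (x \<ominus> y))\<^sup>2 \<le> 4 * m - 2 * val x - 2 * val y"
    if xy: "x \<in> carrier H" "y \<in> carrier H" for x y
  proof -
    have "cinner H y x = cnj (cinner H x y)" using xy by (rule cinner_commute)
    then have "4 * val ((1/2) \<odot> (x \<oplus> y)) = 2 * val x + 2 * val y + (hnorm H (x \<ominus> y))\<^sup>2"
      using xy by (simp add: val_def f_add f_smult hnorm_square cinner_simps algebra_simps)
    moreover have "val ((1/2) \<odot> (x \<oplus> y)) \<le> m" using xy by (intro val_le) simp
    ultimately show ?thesis by linarith
  qed
  have "\<exists>N. \<forall>i\<ge>N. \<forall>j\<ge>N. hnorm H (\<sigma> i \<ominus> \<sigma> j) < \<epsilon>" if "\<epsilon> > 0" for \<epsilon> :: real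
  proof -
    have "0 < \<epsilon>\<^sup>2 / 4" using that by simp
    then obtain N where N: "inverse (real (Suc N)) < \<epsilon>\<^sup>2 / 4"
      using reals_Archimedean by blast
    have "hnorm H (\<sigma> i \<ominus> \<sigma> j) < \<epsilon>" if ij: "i \<ge> N" "j \<ge> N" for i j
    proof -
      have "1 / real (Suc i) < \<epsilon>\<^sup>2 / 4" "1 / real (Suc j) < \<epsilon>\<^sup>2 / 4"
        using N ij by (smt (verit) frac_le inverse_eq_divide of_nat_0_less_iff of_nat_le_iff
            Suc_le_mono zero_less_Suc)+
      then have "(hnorm H (\<sigma> i \<ominus> \<sigma> j))\<^sup>2 < \<epsilon>\<^sup>2"
        using dist[OF \<sigma>(1) \<sigma>(1), of i j] \<sigma>(2)[of i] \<sigma>(2)[of j] by linarith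
      then show ?thesis by (rule power2_less_imp_less) (use \<open>\<epsilon> > 0\<close> in simp)
    qed
    then show ?thesis by blast
  qed
  then obtain x0 where x0: "x0 \<in> carrier H" "(\<lambda>n. hnorm H (\<sigma> n \<ominus> x0)) \<longlonglongrightarrow> 0"
    using complete[of \<sigma>] \<sigma>(1) by blast
  have lim: "(\<lambda>n. cinner H (\<sigma> n) z) \<longlonglongrightarrow> cinner H x0 z" if z: "z \<in> carrier H" for z
  proof (rule LIM_zero_cancel, rule Lim_null_comparison)
    show "\<forall>\<^sub>F n in sequentially. norm (cinner H (\<sigma> n) z - cinner H x0 z)
        \<le> hnorm H (\<sigma> n \<ominus> x0) * hnorm H z"
      using Cauchy_Schwarz[of "\<sigma> n \<ominus> x0" z for n] \<sigma>(1) x0(1) z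
      by (intro always_eventually allI) (simp add: cinner_minus_left)
    show "(\<lambda>n. hnorm H (\<sigma> n \<ominus> x0) * hnorm H z) \<longlonglongrightarrow> 0"
      using tendsto_mult_left_zero[OF x0(2)] .
  qed
  have Re_eq: "Re (f z) = Re (cinner H x0 z)" if z: "z \<in> carrier H" for z
  proof -
    define N where "N = (hnorm H z)\<^sup>2"
    define r where "r = Re (f z) - Re (cinner H x0 z)"
    \<comment> \<open>The value at \<open>\<sigma> n + t z\<close> exceeds the one at \<open>\<sigma> n\<close> by less than \<open>1 / (n + 1)\<close>.\<close>
    have ineq: "2 * t * r \<le> t\<^sup>2 * N" for t
    proof (rule LIMSEQ_le)
      show "(\<lambda>n. 2 * t * (Re (f z) - Re (cinner H (\<sigma> n) z))) \<longlonglongrightarrow> 2 * t * r"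
        unfolding r_def by (intro tendsto_intros lim z)
      have "(\<lambda>n. t\<^sup>2 * N + 1 / real (Suc n)) \<longlonglongrightarrow> t\<^sup>2 * N + 0"
        by (intro tendsto_intros LIMSEQ_Suc lim_1_over_n)
      then show "(\<lambda>n. t\<^sup>2 * N + 1 / real (Suc n)) \<longlonglongrightarrow> t\<^sup>2 * N" by simp
      have "2 * t * (Re (f z) - Re (cinner H (\<sigma> n) z)) \<le> t\<^sup>2 * N + 1 / real (Suc n)" for n
      proof -
        have sym: "cinner H z (\<sigma> n) = cnj (cinner H (\<sigma> n) z)"
          using \<sigma>(1) z by (intro cinner_commute)
        have "cinner H (\<sigma> n \<oplus> of_real t \<odot> z) (\<sigma> n \<oplus> of_real t \<odot> z)
            = cinner H (\<sigma> n) (\<sigma> n) + of_real t * (cinner H (\<sigma> n) z + cinner H z (\<sigma> n))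
              + of_real (t\<^sup>2) * cinner H z z"
          using \<sigma>(1) z by (simp add: cinner_simps distrib_left power2_eq_square)
        then have "(hnorm H (\<sigma> n \<oplus> of_real t \<odot> z))\<^sup>2
            = (hnorm H (\<sigma> n))\<^sup>2 + 2 * t * Re (cinner H (\<sigma> n) z) + t\<^sup>2 * N"
          unfolding N_def using \<sigma>(1) z by (simp add: hnorm_square sym del: of_real_power)
        then have "val (\<sigma> n \<oplus> of_real t \<odot> z)
            = val (\<sigma> n) + 2 * t * (Re (f z) - Re (cinner H (\<sigma> n) z)) - t\<^sup>2 * N"
          using \<sigma>(1) z by (simp add: val_def f_add f_smult right_diff_distrib)
        moreover have "val (\<sigma> n \<oplus> of_real t \<odot> z) \<le> m" using \<sigma>(1) z by (intro val_le) simp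
        ultimately show ?thesis using \<sigma>(2)[of n] by linarith
      qed
      then show "\<exists>M. \<forall>n\<ge>M. 2 * t * (Re (f z) - Re (cinner H (\<sigma> n) z)) \<le> t\<^sup>2 * N + 1 / real (Suc n)"
        by blast
    qed
    have "N \<ge> 0" by (simp add: N_def)
    \<comment> \<open>The maximiser \<open>t = r / N\<close> of \<open>2 t r - t\<^sup>2 N\<close>, shifted so that \<open>N = 0\<close> is allowed.\<close>
    have "2 * (r / (N + 1)) * r \<le> (r / (N + 1))\<^sup>2 * N" by (rule ineq)
    then have "2 * r\<^sup>2 * (N + 1) \<le> r\<^sup>2 * N"
      using \<open>N \<ge> 0\<close> by (simp add: divide_simps power2_eq_square split: if_splits)
    then have "r\<^sup>2 * (N + 2) \<le> 0" by (simp add: algebra_simps)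
    then have "r = 0" using \<open>N \<ge> 0\<close> by (simp add: mult_le_0_iff)
    then show ?thesis by (simp add: r_def)
  qed
  have "cinner H x0 z = f z" if z: "z \<in> carrier H" for z
    using Re_eq[OF z] Re_eq[of "\<i> \<odot> z"] z x0(1)
    by (simp add: complex_eq_iff f_smult cinner_smult_right)
  then show ?thesis using x0(1) by blast
qed

end

text \<open>The adjoint is a definite description, hence known only once a vector with the defining
property has been exhibited. For bounded operators the Riesz representation does this.\<close>

lemma hadj_eqI:
  assumes "hilbert_space H" "x \<in> carrier H" "\<And>z. z \<in> carrier H \<Longrightarrow> cinner H x z = cinner K y (T z)"
  shows "hadj H K T y = x"
proof -
  interpret hilbert_space H by fact
  have "x' = x" if "x' \<in> carrier H \<and> (\<forall>z\<in>carrier H. cinner H x' z = cinner K y (T z))" for x'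
  proof (rule cinner_ext)
    show "cinner H z x' = cinner H z x" if z: "z \<in> carrier H" for z
      using cinner_commute[OF _ z, of x] cinner_commute[OF _ z, of x'] \<open>x' \<in> _ \<and> _\<close> assms(2,3) z
      by simp
  qed (use that assms(2) in auto)
  then show ?thesis unfolding hadj_def using assms(2,3) by (intro the_equality) auto
qed

lemma bounded_opsD:
  assumes "T \<in> bounded_ops H K"
  shows "x \<in> carrier H \<Longrightarrow> T x \<in> carrier K"
    and "\<lbrakk>x \<in> carrier H; y \<in> carrier H\<rbrakk> \<Longrightarrow> T (x \<oplus>\<^bsub>H\<^esub> y) = T x \<oplus>\<^bsub>K\<^esub> T y"
    and "x \<in> carrier H \<Longrightarrow> T (c \<odot>\<^bsub>H\<^esub> x) = c \<odot>\<^bsub>K\<^esub> T x"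
  using assms by (auto simp: bounded_ops_def)

lemma bounded_ops_bound:
  assumes "T \<in> bounded_ops H K" "hilbert_space H"
  obtains C where "C \<ge> 0" "\<And>x. x \<in> carrier H \<Longrightarrow> hnorm K (T x) \<le> C * hnorm H x"
proof -
  interpret hilbert_space H by fact
  obtain C where C: "\<forall>x\<in>carrier H. hnorm K (T x) \<le> C * hnorm H x"
    using assms by (auto simp: bounded_ops_def)
  have "hnorm K (T x) \<le> \<bar>C\<bar> * hnorm H x" if "x \<in> carrier H" for x
    using C that mult_right_mono[OF abs_ge_self hnorm_nonneg[OF that], of C] by fastforce
  then show ?thesis using that[of "\<bar>C\<bar>"] by simp
qed

lemma
  assumes "hilbert_space H" "hilbert_space K" "T \<in> bounded_ops H K" "y \<in> carrier K"
  shows hadj_carrier: "hadj H K T y \<in> carrier H"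
    and cinner_hadj_left: "z \<in> carrier H \<Longrightarrow> cinner H (hadj H K T y) z = cinner K y (T z)"
    and cinner_hadj_right: "z \<in> carrier H \<Longrightarrow> cinner H z (hadj H K T y) = cinner K (T z) y"
proof -
  interpret H: hilbert_space H by fact
  interpret K: hilbert_space K by fact
  note T = bounded_opsD[OF assms(3)]
  obtain C where C: "C \<ge> 0" "\<And>x. x \<in> carrier H \<Longrightarrow> hnorm K (T x) \<le> C * hnorm H x"
    using bounded_ops_bound[OF assms(3,1)] by blast
  have "\<exists>x\<in>carrier H. \<forall>z\<in>carrier H. cinner H x z = cinner K y (T z)"
  proof (rule H.Riesz_representation)
    fix x assume x: "x \<in> carrier H"
    have "cmod (cinner K y (T x)) \<le> hnorm K y * hnorm K (T x)"
      using x assms(4) T by (intro K.Cauchy_Schwarz)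
    also have "\<dots> \<le> hnorm K y * (C * hnorm H x)"
      using C(2)[OF x] assms(4) by (intro mult_left_mono) auto
    finally show "cmod (cinner K y (T x)) \<le> (hnorm K y * C) * hnorm H x" by (simp add: ac_simps)
  qed (use T assms(4) in \<open>simp_all add: K.cinner_simps\<close>)
  then obtain x where x: "x \<in> carrier H" "\<And>z. z \<in> carrier H \<Longrightarrow> cinner H x z = cinner K y (T z)"
    by blast
  then have eq: "hadj H K T y = x" using assms(1) by (rule_tac hadj_eqI)
  show c: "hadj H K T y \<in> carrier H" by (simp add: eq x)
  show l: "z \<in> carrier H \<Longrightarrow> cinner H (hadj H K T y) z = cinner K y (T z)" for z by (simp add: eq x)
  show "cinner H z (hadj H K T y) = cinner K (T z) y" if z: "z \<in> carrier H"
    using H.cinner_commute[OF c z] K.cinner_commute[OF assms(4) T(1)[OF z]] l[OF z] by simp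
qed

lemma hadj_bounded_ops:
  assumes "hilbert_space H" "hilbert_space K" "T \<in> bounded_ops H K"
  shows "hadj H K T \<in> bounded_ops K H"
proof -
  interpret H: hilbert_space H by fact
  interpret K: hilbert_space K by fact
  note T = bounded_opsD[OF assms(3)]
  note hc = hadj_carrier[OF assms]
  note hr = cinner_hadj_right[OF assms]
  obtain C where C: "C \<ge> 0" "\<And>x. x \<in> carrier H \<Longrightarrow> hnorm K (T x) \<le> C * hnorm H x"
    using bounded_ops_bound[OF assms(3,1)] by blast
  have "hnorm H (hadj H K T y) \<le> C * hnorm K y" if y: "y \<in> carrier K" for y
  proof -
    let ?z = "hadj H K T y"
    have z: "?z \<in> carrier H" using hc y by simp
    have "(hnorm H ?z)\<^sup>2 = Re (cinner K (T ?z) y)"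
      using z y by (simp add: H.hnorm_square hr)
    also have "\<dots> \<le> hnorm K (T ?z) * hnorm K y"
      using K.Cauchy_Schwarz[OF T(1)[OF z] y] complex_Re_le_cmod order_trans by blast
    also have "\<dots> \<le> (C * hnorm H ?z) * hnorm K y"
      using C(2)[OF z] y by (intro mult_right_mono) auto
    finally have "hnorm H ?z * hnorm H ?z \<le> hnorm H ?z * (C * hnorm K y)"
      by (simp add: power2_eq_square ac_simps)
    then show ?thesis
      using H.hnorm_nonneg[OF z] C(1) K.hnorm_nonneg[OF y]
      by (cases "hnorm H ?z = 0") (auto simp: mult_le_cancel_left)
  qed
  moreover have "hadj H K T (x \<oplus>\<^bsub>K\<^esub> y) = hadj H K T x \<oplus>\<^bsub>H\<^esub> hadj H K T y"
    if "x \<in> carrier K" "y \<in> carrier K" for x y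
    using that by (intro H.cinner_ext) (simp_all add: hc hr H.cinner_simps K.cinner_simps T)
  moreover have "hadj H K T (c \<odot>\<^bsub>K\<^esub> x) = c \<odot>\<^bsub>H\<^esub> hadj H K T x" if "x \<in> carrier K" for c x
    using that by (intro H.cinner_ext) (simp_all add: hc hr H.cinner_simps K.cinner_simps T)
  ultimately show ?thesis using hc by (auto simp: bounded_ops_def)
qed

lemma hadj_hadj:
  assumes "hilbert_space H" "hilbert_space K" "T \<in> bounded_ops H K" "x \<in> carrier H"
  shows "hadj K H (hadj H K T) x = T x"
  using assms by (intro hadj_eqI) (simp_all add: cinner_hadj_right bounded_opsD(1))

section \<open>Reproducing kernel Hilbert spaces\<close>

text \<open>A list of pairs \<open>(z, s)\<close> stands for the formal linear combination \<open>\<Sum> z e\<^sub>s\<close>, and \<open>pairing c f\<close> is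
the inner product of \<open>c\<close> with a vector \<open>f\<close> that is given by its coefficients \<open>f s = \<langle>e\<^sub>s, f\<rangle>\<close>.
Lists allow a combination to be moved along an arbitrary, possibly non-injective, map of the
index set.\<close>

definition pairing :: "(complex \<times> 's) list \<Rightarrow> ('s \<Rightarrow> complex) \<Rightarrow> complex" where
  "pairing c f = (\<Sum>(z, s)\<leftarrow>c. cnj z * f s)"

definition scale_comb :: "complex \<Rightarrow> (complex \<times> 's) list \<Rightarrow> (complex \<times> 's) list" where
  "scale_comb a = map (\<lambda>(z, s). (a * z, s))"

text \<open>The coefficient function of \<open>\<Sum> w e\<^sub>s\<close> if \<open>\<langle>e\<^sub>t, e\<^sub>s\<rangle> = k t s\<close>.\<close>

definition kernel_comb :: "('s \<Rightarrow> 's \<Rightarrow> complex) \<Rightarrow> (complex \<times> 's) list \<Rightarrow> 's \<Rightarrow> complex" where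
  "kernel_comb k d t = (\<Sum>(w, s)\<leftarrow>d. w * k t s)"

lemma pairing_simps [simp]:
  "pairing [] f = 0"
  "pairing ((z, s) # c) f = cnj z * f s + pairing c f"
  "pairing (c @ d) f = pairing c f + pairing d f"
  "pairing (scale_comb a c) f = cnj a * pairing c f"
  by (induction c) (auto simp: pairing_def scale_comb_def algebra_simps)

lemma pairing_fun_simps [simp]:
  "pairing c (\<lambda>_. 0) = 0"
  "pairing c (\<lambda>s. f s + g s) = pairing c f + pairing c g"
  "pairing c (\<lambda>s. f s - g s) = pairing c f - pairing c g"
  "pairing c (\<lambda>s. a * f s) = a * pairing c f"
  "pairing c (\<lambda>s. - f s) = - pairing c f"
  by (induction c) (auto simp: pairing_def algebra_simps)

lemma kernel_comb_simps:
  "kernel_comb k [] = (\<lambda>t. 0)"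
  "kernel_comb k ((w, s) # d) = (\<lambda>t. w * k t s + kernel_comb k d t)"
  "kernel_comb k (c @ d) = (\<lambda>t. kernel_comb k c t + kernel_comb k d t)"
  "kernel_comb k (scale_comb a c) = (\<lambda>t. a * kernel_comb k c t)"
  by (induction c) (auto simp: kernel_comb_def scale_comb_def algebra_simps fun_eq_iff)

definition move_comb :: "('s \<Rightarrow> 't) \<Rightarrow> (complex \<times> 's) list \<Rightarrow> (complex \<times> 't) list" where
  "move_comb m = map (\<lambda>(z, s). (z, m s))"

lemma pairing_move_comb: "pairing (move_comb m c) f = pairing c (\<lambda>s. f (m s))"
  by (induction c) (auto simp: pairing_def move_comb_def)

lemma pairing_cong: "(\<And>s. f s = g s) \<Longrightarrow> pairing c f = pairing c g"
  by (metis ext)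

lemma tendsto_pairing:
  assumes "\<And>s. (\<lambda>n. F n s) \<longlonglongrightarrow> f s"
  shows "(\<lambda>n. pairing c (F n)) \<longlonglongrightarrow> pairing c f"
proof (induction c)
  case (Cons p c)
  then show ?case by (cases p) (auto intro!: tendsto_intros assms)
qed simp

text \<open>A discriminant estimate: for \<open>b > 0\<close> the left-hand side of \<open>quad\<close> is largest at \<open>t = a / b\<close>.\<close>

lemma le_square_if_quadratic_le:
  fixes a b M :: real
  assumes quad: "\<And>t. 2 * t * a - t\<^sup>2 * b \<le> M" and b: "b \<ge> 0"
  shows "a\<^sup>2 \<le> M * b"
proof (cases "b = 0")
  case True
  have "a = 0"
  proof (rule ccontr)
    assume "a \<noteq> 0"
    with quad[of "(M + 1) / (2 * a)"] True show False by simp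
  qed
  then show ?thesis using True by simp
next
  case False
  with b have b: "b > 0" by simp
  have "2 * (a / b) * a - (a / b)\<^sup>2 * b \<le> M" by (rule quad)
  then have "a\<^sup>2 / b \<le> M" using b by (simp add: power2_eq_square)
  then show ?thesis using b by (simp add: field_simps)
qed

text \<open>The Hilbert space of the kernel is built as the space \<open>D\<close> of all functions \<open>f\<close> for which
\<open>c \<mapsto> pairing c f\<close> is bounded with respect to the seminorm \<open>\<surd>Q\<close> of formal combinations, that is,
as the antidual of the pre-Hilbert space of combinations.\<close>

locale pos_kernel =
  fixes k :: "'s \<Rightarrow> 's \<Rightarrow> complex"
  assumes herm: "k t s = cnj (k s t)"
    and pos: "0 \<le> Re (pairing c (kernel_comb k c))"
begin

abbreviation K where "K \<equiv> kernel_comb k"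
definition Q where "Q c = Re (pairing c (K c))"

lemma Q_nonneg [simp]: "0 \<le> Q c" by (simp add: Q_def pos)

lemma pairing_K_commute: "pairing d (K c) = cnj (pairing c (K d))"
proof (induction c)
  case Nil
  then show ?case by (simp add: kernel_comb_simps)
next
  case (Cons p c)
  obtain z s where p: "p = (z, s)" by fastforce
  have "pairing d (\<lambda>t. k t s) = cnj (K d s)"
    unfolding kernel_comb_def pairing_def
    by (induction d) (auto simp: herm[of _ s])
  then show ?case using Cons by (simp add: p kernel_comb_simps)
qed

lemma Q_append: "Q (c @ d) = Q c + 2 * Re (pairing c (K d)) + Q d"
  using pairing_K_commute[of d c] by (simp add: Q_def kernel_comb_simps)

lemma Q_scale: "Q (scale_comb a c) = (cmod a)\<^sup>2 * Q c"
proof -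
  have "pairing (scale_comb a c) (K (scale_comb a c)) = (a * cnj a) * pairing c (K c)"
    by (simp add: kernel_comb_simps)
  also have "a * cnj a = of_real ((cmod a)\<^sup>2)" by (rule complex_norm_square[symmetric])
  finally show ?thesis by (simp add: Q_def del: of_real_power)
qed

text \<open>The squared dual norm \<open>q\<close> is written as the convex conjugate of \<open>Q\<close> and not as a supremum over
unit vectors: in this form its behaviour under adding a kernel combination is an exact
identity (\<open>q_shift\<close>), from which density and the inner product are derived.\<close>

definition D :: "('s \<Rightarrow> complex) set" where
  "D = {f. bdd_above (range (\<lambda>c. 2 * Re (pairing c f) - Q c))}"
definition q :: "('s \<Rightarrow> complex) \<Rightarrow> real" where
  "q f = (SUP c. 2 * Re (pairing c f) - Q c)"

lemma q_upper: "f \<in> D \<Longrightarrow> 2 * Re (pairing c f) - Q c \<le> q f"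
  unfolding q_def D_def by (auto intro: cSUP_upper)

lemma D_intro:
  assumes "\<And>c. 2 * Re (pairing c f) - Q c \<le> M"
  shows "f \<in> D" "q f \<le> M"
proof -
  show "f \<in> D" unfolding D_def mem_Collect_eq by (rule bdd_aboveI2[OF assms])
  show "q f \<le> M" unfolding q_def by (rule cSUP_least[OF UNIV_not_empty assms])
qed

lemma q_nonneg [simp]: "f \<in> D \<Longrightarrow> 0 \<le> q f"
  using q_upper[of f "[]"] by (simp add: Q_def)

lemma pairing_bound_square:
  assumes "f \<in> D"
  shows "(cmod (pairing c f))\<^sup>2 \<le> q f * Q c"
proof (rule le_square_if_quadratic_le)
  fix t :: real
  define p where "p = pairing c f"
  \<comment> \<open>Rotating by the phase of the pairing makes it real.\<close>
  define a where "a = of_real t * sgn p"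
  have "cnj (sgn p) * p = of_real (cmod p)"
    using complex_norm_square[of p]
    by (cases "p = 0") (simp_all add: sgn_div_norm scaleR_conv_of_real field_simps power2_eq_square)
  then have "pairing (scale_comb a c) f = of_real (t * cmod p)"
    by (simp add: a_def flip: p_def)
  moreover have "Q (scale_comb a c) \<le> t\<^sup>2 * Q c"
    by (simp add: Q_scale a_def norm_mult norm_sgn power_mult_distrib mult_left_mono)
  ultimately show "2 * t * cmod p - t\<^sup>2 * Q c \<le> q f"
    using q_upper[OF assms, of "scale_comb a c"] by simp
qed simp

definition nrm :: "('s \<Rightarrow> complex) \<Rightarrow> real" where "nrm f = sqrt (q f)"

lemma nrm_nonneg [simp]: "f \<in> D \<Longrightarrow> 0 \<le> nrm f" by (simp add: nrm_def)

lemma q_eq_nrm: "f \<in> D \<Longrightarrow> q f = (nrm f)\<^sup>2" by (simp add: nrm_def)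

lemma pairing_bound: "f \<in> D \<Longrightarrow> cmod (pairing c f) \<le> nrm f * sqrt (Q c)"
  using real_le_rsqrt[OF pairing_bound_square] by (simp add: nrm_def real_sqrt_mult)

lemma D_intro_bound:
  assumes "\<And>c. cmod (pairing c f) \<le> m * sqrt (Q c)" "0 \<le> m"
  shows "f \<in> D" "nrm f \<le> m"
proof -
  have *: "2 * Re (pairing c f) - Q c \<le> m\<^sup>2" for c
  proof -
    have "0 \<le> (m - sqrt (Q c))\<^sup>2" by simp
    then have "2 * (m * sqrt (Q c)) - Q c \<le> m\<^sup>2" by (simp add: power2_diff)
    then show ?thesis using assms(1)[of c] complex_Re_le_cmod[of "pairing c f"] by linarith
  qed
  show "f \<in> D" using D_intro(1)[OF *] .
  have "q f \<le> m\<^sup>2" using D_intro(2)[OF *] .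
  then show "nrm f \<le> m" using assms(2) by (simp add: nrm_def real_le_lsqrt)
qed

lemma
  assumes "f \<in> D" "g \<in> D"
  shows D_add: "(\<lambda>s. f s + g s) \<in> D" and nrm_triangle: "nrm (\<lambda>s. f s + g s) \<le> nrm f + nrm g"
proof -
  have "cmod (pairing c (\<lambda>s. f s + g s)) \<le> (nrm f + nrm g) * sqrt (Q c)" for c
    using norm_triangle_ineq[of "pairing c f" "pairing c g"]
      pairing_bound[OF assms(1), of c] pairing_bound[OF assms(2), of c] by (simp add: distrib_right)
  then show "(\<lambda>s. f s + g s) \<in> D" "nrm (\<lambda>s. f s + g s) \<le> nrm f + nrm g"
    using assms by (auto intro!: D_intro_bound[where m = "nrm f + nrm g"])
qed

lemma
  assumes "f \<in> D"
  shows D_scale: "(\<lambda>s. a * f s) \<in> D" and nrm_scale: "nrm (\<lambda>s. a * f s) = cmod a * nrm f"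
proof -
  have le: "(\<lambda>s. a * f s) \<in> D \<and> nrm (\<lambda>s. a * f s) \<le> cmod a * nrm f" if "f \<in> D" for a f
  proof -
    have "cmod (pairing c (\<lambda>s. a * f s)) \<le> (cmod a * nrm f) * sqrt (Q c)" for c
      using mult_left_mono[OF pairing_bound[OF that, of c], of "cmod a"] by (simp add: norm_mult ac_simps)
    then show ?thesis using that by (auto intro!: D_intro_bound[where m = "cmod a * nrm f"])
  qed
  show D: "(\<lambda>s. a * f s) \<in> D" using le[OF assms] by blast
  show "nrm (\<lambda>s. a * f s) = cmod a * nrm f"
  proof (cases "a = 0")
    case True
    then show ?thesis using le[OF assms, of 0] nrm_nonneg[of "\<lambda>s. 0"] by (auto simp: antisym)
  next
    case False
    have "nrm (\<lambda>s. inverse a * (a * f s)) \<le> cmod (inverse a) * nrm (\<lambda>s. a * f s)"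
      using le[OF D] by blast
    then have "nrm f \<le> inverse (cmod a) * nrm (\<lambda>s. a * f s)"
      using False by (simp add: norm_inverse flip: mult.assoc)
    then have "cmod a * nrm f \<le> nrm (\<lambda>s. a * f s)"
      using False by (simp add: field_simps)
    then show ?thesis using le[OF assms, of a] by linarith
  qed
qed

lemma D_zero [simp]: "(\<lambda>s. 0) \<in> D"
  by (rule D_intro_bound(1)[where m = 0]) auto

lemma D_uminus: "f \<in> D \<Longrightarrow> (\<lambda>s. - f s) \<in> D" and nrm_uminus: "f \<in> D \<Longrightarrow> nrm (\<lambda>s. - f s) = nrm f"
  using D_scale[of f "-1"] nrm_scale[of f "-1"] by auto

lemma D_diff: "f \<in> D \<Longrightarrow> g \<in> D \<Longrightarrow> (\<lambda>s. f s - g s) \<in> D"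
  using D_add[OF _ D_uminus, of f g] by simp

lemma nrm_diff_commute: "f \<in> D \<Longrightarrow> g \<in> D \<Longrightarrow> nrm (\<lambda>s. f s - g s) = nrm (\<lambda>s. g s - f s)"
  using nrm_uminus[OF D_diff, of f g] by simp

lemma nrm_triangle_rev:
  assumes "f \<in> D" "g \<in> D"
  shows "\<bar>nrm f - nrm g\<bar> \<le> nrm (\<lambda>s. f s - g s)"
  using nrm_triangle[OF D_diff[OF assms] assms(2)] nrm_triangle[OF D_diff[OF assms(2,1)] assms(1)]
    nrm_diff_commute[OF assms] by simp

lemma
  assumes "f \<in> D"
  shows D_shift: "(\<lambda>s. f s + K c s) \<in> D"
    and q_shift: "q (\<lambda>s. f s + K c s) = q f + 2 * Re (pairing c f) + Q c"
proof -
  have le: "(\<lambda>s. f s + K c s) \<in> D \<and> q (\<lambda>s. f s + K c s) \<le> q f + 2 * Re (pairing c f) + Q c"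
    if "f \<in> D" for f c
  proof -
    \<comment> \<open>Completing the square: the supremum over \<open>d\<close> is the one for \<open>f\<close> over \<open>d - c\<close>.\<close>
    have "2 * Re (pairing d (\<lambda>s. f s + K c s)) - Q d \<le> q f + 2 * Re (pairing c f) + Q c" for d
    proof -
      have "Q (d @ scale_comb (-1) c) = Q d - 2 * Re (pairing d (K c)) + Q c"
        by (simp add: Q_append Q_scale kernel_comb_simps)
      then show ?thesis using q_upper[OF that, of "d @ scale_comb (-1) c"] by simp
    qed
    then show ?thesis using D_intro by blast
  qed
  show D: "(\<lambda>s. f s + K c s) \<in> D" using le[OF assms] by blast
  have "q f \<le> q (\<lambda>s. f s + K c s) - 2 * Re (pairing c (\<lambda>s. f s + K c s)) + Q c"
    using le[OF D, of "scale_comb (-1) c"] by (simp add: Q_scale kernel_comb_simps)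
  then show "q (\<lambda>s. f s + K c s) = q f + 2 * Re (pairing c f) + Q c"
    using le[OF assms, of c] by (simp add: Q_def)
qed

lemma K_in_D [simp]: "K c \<in> D" and q_K: "q (K c) = Q c"
proof -
  show D: "K c \<in> D" using D_shift[OF D_zero, of c] by simp
  have "q (\<lambda>s. 0) = 0" using D_intro(2)[of "\<lambda>s. 0" 0] q_nonneg[OF D_zero] by simp
  then show "q (K c) = Q c" using q_shift[OF D_zero, of c] by simp
qed

text \<open>A combination that nearly attains the supremum defining \<open>q f\<close> is a good approximation of \<open>f\<close>,
because by \<open>q_shift\<close> its defect is the squared distance.\<close>

lemma K_dense:
  assumes "f \<in> D" "\<epsilon> > 0"
  shows "\<exists>c. nrm (\<lambda>s. f s - K c s) < \<epsilon>"
proof -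
  have "q f - \<epsilon>\<^sup>2 < (SUP c. 2 * Re (pairing c f) - Q c)" using assms(2) by (simp flip: q_def)
  then obtain c where c: "q f - \<epsilon>\<^sup>2 < 2 * Re (pairing c f) - Q c"
    using assms(1) by (subst (asm) less_cSUP_iff) (auto simp: D_def)
  have "q (\<lambda>s. f s - K c s) = q f - 2 * Re (pairing c f) + Q c"
    using q_shift[OF assms(1), of "scale_comb (-1) c"] by (simp add: Q_scale kernel_comb_simps)
  then have "q (\<lambda>s. f s - K c s) < \<epsilon>\<^sup>2" using c by linarith
  then have "nrm (\<lambda>s. f s - K c s) < sqrt (\<epsilon>\<^sup>2)" unfolding nrm_def by (rule real_sqrt_less_mono)
  then show ?thesis using assms(2) by auto
qed

text \<open>The inner product is obtained from \<open>q\<close> by polarization. Its linearity in the second argument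
comes from density: if \<open>f\<close> is a kernel combination then \<open>re_inner f g\<close> is the real part of a
pairing, which is linear in \<open>g\<close>, and this passes to the limit.\<close>

definition re_inner :: "('s \<Rightarrow> complex) \<Rightarrow> ('s \<Rightarrow> complex) \<Rightarrow> real" where
  "re_inner f g = (q (\<lambda>s. f s + g s) - q (\<lambda>s. f s - g s)) / 4"

lemma re_inner_K: "g \<in> D \<Longrightarrow> re_inner (K c) g = Re (pairing c g)"
  using q_shift[of g c] q_shift[of g "scale_comb (-1) c"] q_eq_nrm[OF D_diff, of "K c" g]
    q_eq_nrm[OF D_diff, of g "K c"] nrm_diff_commute[of "K c" g]
  by (simp add: re_inner_def Q_scale kernel_comb_simps add.commute[of "K c _"])

lemma re_inner_commute: "f \<in> D \<Longrightarrow> g \<in> D \<Longrightarrow> re_inner f g = re_inner g f"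
  using q_eq_nrm[OF D_diff, of f g] q_eq_nrm[OF D_diff, of g f] nrm_diff_commute[of f g]
  by (simp add: re_inner_def add.commute)

lemma re_inner_self:
  assumes "f \<in> D"
  shows "re_inner f f = q f"
proof -
  have "q (\<lambda>s. f s + f s) = 4 * q f"
    using nrm_scale[OF assms, of 2] q_eq_nrm[OF D_add[OF assms assms]] q_eq_nrm[OF assms]
    by (simp add: power_mult_distrib flip: mult_2)
  moreover have "q (\<lambda>s. 0) = 0" using q_K[of "[]"] by (simp add: kernel_comb_simps Q_def)
  ultimately show ?thesis by (simp add: re_inner_def)
qed

lemma re_inner_rotate:
  assumes "f \<in> D" "g \<in> D"
  shows "re_inner (\<lambda>s. \<i> * f s) (\<lambda>s. \<i> * g s) = re_inner f g"
proof -
  have "q (\<lambda>s. \<i> * h s) = q h" if "h \<in> D" for h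
    using nrm_scale[OF that, of \<i>] D_scale[OF that, of \<i>] that by (simp add: q_eq_nrm)
  from this[OF D_add[OF assms]] this[OF D_diff[OF assms]] show ?thesis
    by (simp add: re_inner_def distrib_left right_diff_distrib)
qed

text \<open>One sequence of combinations approximates \<open>f\<close> against all \<open>g\<close> simultaneously, which is what
transfers linearity in \<open>g\<close>.\<close>

lemma re_inner_limit:
  assumes "f \<in> D"
  shows "\<exists>c. \<forall>g\<in>D. (\<lambda>n. Re (pairing (c n) g)) \<longlonglongrightarrow> re_inner f g"
proof -
  have "\<exists>c. nrm (\<lambda>s. f s - K c s) < 1 / real (Suc n)" for n
    by (rule K_dense[OF assms]) simp
  then obtain c where c: "\<And>n. nrm (\<lambda>s. f s - K (c n) s) < 1 / real (Suc n)" by metis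
  have lim: "(\<lambda>n. q (\<lambda>s. K (c n) s + g s)) \<longlonglongrightarrow> q (\<lambda>s. f s + g s)" if g: "g \<in> D" for g
  proof -
    have "(\<lambda>n. nrm (\<lambda>s. K (c n) s + g s)) \<longlonglongrightarrow> nrm (\<lambda>s. f s + g s)"
    proof (rule LIM_zero_cancel, rule Lim_null_comparison)
      have "norm (nrm (\<lambda>s. K (c n) s + g s) - nrm (\<lambda>s. f s + g s)) \<le> 1 / real (Suc n)" for n
        using nrm_triangle_rev[OF D_add[OF K_in_D[of "c n"] g] D_add[OF assms g]]
          nrm_diff_commute[OF K_in_D[of "c n"] assms] c[of n] by simp
      then show "\<forall>\<^sub>F n in sequentially.
          norm (nrm (\<lambda>s. K (c n) s + g s) - nrm (\<lambda>s. f s + g s)) \<le> 1 / real (Suc n)"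
        by (intro always_eventually allI)
    qed (intro LIMSEQ_Suc lim_1_over_n)
    then have "(\<lambda>n. (nrm (\<lambda>s. K (c n) s + g s))\<^sup>2) \<longlonglongrightarrow> (nrm (\<lambda>s. f s + g s))\<^sup>2"
      by (rule tendsto_power)
    then show ?thesis using D_add[OF K_in_D g] D_add[OF assms g] by (simp add: q_eq_nrm)
  qed
  have "(\<lambda>n. Re (pairing (c n) g)) \<longlonglongrightarrow> re_inner f g" if g: "g \<in> D" for g
  proof -
    have "(\<lambda>n. re_inner (K (c n)) g) \<longlonglongrightarrow> re_inner f g"
      unfolding re_inner_def using lim[OF g] lim[OF D_uminus[OF g]] by (intro tendsto_intros) simp_all
    then show ?thesis using g by (simp add: re_inner_K)
  qed
  then show ?thesis by blast
qed

lemma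
  assumes "f \<in> D" "g \<in> D"
  shows re_inner_add: "h \<in> D \<Longrightarrow> re_inner f (\<lambda>s. g s + h s) = re_inner f g + re_inner f h"
    and re_inner_scale: "re_inner f (\<lambda>s. of_real r * g s) = r * re_inner f g"
proof -
  obtain c where c: "\<And>g. g \<in> D \<Longrightarrow> (\<lambda>n. Re (pairing (c n) g)) \<longlonglongrightarrow> re_inner f g"
    using re_inner_limit[OF assms(1)] by blast
  show "re_inner f (\<lambda>s. g s + h s) = re_inner f g + re_inner f h" if "h \<in> D"
    using tendsto_add[OF c[OF assms(2)] c[OF that]] c[OF D_add[OF assms(2) that]]
    by (simp add: LIMSEQ_unique)
  show "re_inner f (\<lambda>s. of_real r * g s) = r * re_inner f g"
    using tendsto_mult_left[OF c[OF assms(2)], of r] c[OF D_scale[OF assms(2), of "of_real r"]]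
    by (simp add: LIMSEQ_unique)
qed

definition inner :: "('s \<Rightarrow> complex) \<Rightarrow> ('s \<Rightarrow> complex) \<Rightarrow> complex" where
  "inner f g = Complex (re_inner f g) (- re_inner f (\<lambda>s. \<i> * g s))"

lemma inner_add:
  "\<lbrakk>f \<in> D; g \<in> D; h \<in> D\<rbrakk> \<Longrightarrow> inner f (\<lambda>s. g s + h s) = inner f g + inner f h"
  by (simp add: inner_def complex_eq_iff distrib_left re_inner_add D_scale)

lemma inner_scale:
  assumes "f \<in> D" "g \<in> D"
  shows "inner f (\<lambda>s. a * g s) = a * inner f g"
proof -
  note D = D_scale[OF assms(2)]
  \<comment> \<open>A real-linear functional is turned into a complex-linear one by \<open>g \<mapsto> L g - \<i> L (\<i> g)\<close>.\<close>
  have *: "re_inner f (\<lambda>s. a * g s) = Re a * re_inner f g + Im a * re_inner f (\<lambda>s. \<i> * g s)" for a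
  proof -
    have "(\<lambda>s. a * g s) = (\<lambda>s. of_real (Re a) * g s + of_real (Im a) * (\<i> * g s))"
      by (subst complex_eq[of a]) (simp add: algebra_simps)
    then show ?thesis
      by (simp only: re_inner_add[OF assms(1) D D_scale[OF D]] re_inner_scale[OF assms(1) D]
          re_inner_scale[OF assms])
  qed
  have "(\<lambda>s. \<i> * (a * g s)) = (\<lambda>s. (\<i> * a) * g s)" by (simp add: mult.assoc)
  then show ?thesis using *[of a] *[of "\<i> * a"] by (simp add: inner_def complex_eq_iff)
qed

lemma inner_commute:
  assumes "f \<in> D" "g \<in> D"
  shows "inner g f = cnj (inner f g)"
proof -
  have "re_inner g (\<lambda>s. \<i> * f s) = re_inner (\<lambda>s. \<i> * g s) (\<lambda>s. \<i> * (\<i> * f s))"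
    using assms D_scale by (simp only: re_inner_rotate)
  also have "\<dots> = re_inner (\<lambda>s. \<i> * g s) (\<lambda>s. of_real (-1) * f s)" by (simp flip: mult.assoc)
  also have "\<dots> = - re_inner (\<lambda>s. \<i> * g s) f"
    by (subst re_inner_scale) (simp_all add: D_scale assms)
  also have "re_inner (\<lambda>s. \<i> * g s) f = re_inner f (\<lambda>s. \<i> * g s)"
    by (simp add: re_inner_commute D_scale assms)
  finally show ?thesis
    using re_inner_commute[OF assms] by (simp add: inner_def complex_eq_iff)
qed

lemma inner_self: "f \<in> D \<Longrightarrow> inner f f = of_real (q f)"
  using inner_commute[of f f] by (simp add: inner_def complex_eq_iff re_inner_self)

lemma inner_K: "g \<in> D \<Longrightarrow> inner (K c) g = pairing c g"
  by (simp add: inner_def re_inner_K D_scale complex_eq_iff)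

lemma q_zero_imp:
  assumes "f \<in> D" "q f = 0"
  shows "f = (\<lambda>s. 0)"
proof
  fix s
  show "f s = 0" using pairing_bound_square[OF assms(1), of "[(1, s)]"] assms(2) by simp
qed

text \<open>Evaluations are continuous, so a Cauchy sequence has a pointwise limit; the bounds on the
pairings with \<open>\<sigma> m - \<sigma> n\<close> survive in the limit \<open>n \<rightarrow> \<infinity>\<close>.\<close>

lemma complete_D:
  assumes D: "\<And>n::nat. \<sigma> n \<in> D"
    and Cauchy: "\<And>\<epsilon>. \<epsilon> > 0 \<Longrightarrow> \<exists>N. \<forall>m\<ge>N. \<forall>n\<ge>N. nrm (\<lambda>s. \<sigma> m s - \<sigma> n s) < \<epsilon>"
  shows "\<exists>f\<in>D. (\<lambda>n. nrm (\<lambda>s. \<sigma> n s - f s)) \<longlonglongrightarrow> 0"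
proof -
  have bound: "cmod (pairing c (\<sigma> m) - pairing c (\<sigma> n)) \<le> nrm (\<lambda>s. \<sigma> m s - \<sigma> n s) * sqrt (Q c)" for c m n
    using pairing_bound[OF D_diff[OF D[of m] D[of n]], of c] by simp
  have "convergent (\<lambda>n. \<sigma> n s)" for s
    unfolding Cauchy_convergent_iff[symmetric]
  proof (rule metric_CauchyI)
    fix \<epsilon> :: real assume "\<epsilon> > 0"
    define r where "r = sqrt (Q [(1, s)])"
    have "r \<ge> 0" by (simp add: r_def)
    then obtain N where N: "\<forall>m\<ge>N. \<forall>n\<ge>N. nrm (\<lambda>s. \<sigma> m s - \<sigma> n s) < \<epsilon> / (r + 1)"
      using Cauchy[of "\<epsilon> / (r + 1)"] \<open>\<epsilon> > 0\<close> by auto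
    have "dist (\<sigma> m s) (\<sigma> n s) < \<epsilon>" if "m \<ge> N" "n \<ge> N" for m n
    proof -
      have "dist (\<sigma> m s) (\<sigma> n s) \<le> nrm (\<lambda>s. \<sigma> m s - \<sigma> n s) * r"
        using bound[of "[(1, s)]" m n] by (simp add: dist_norm r_def)
      also have "\<dots> \<le> \<epsilon> / (r + 1) * r"
        using N that \<open>r \<ge> 0\<close> by (intro mult_right_mono) (auto simp: less_imp_le)
      also have "\<dots> < \<epsilon>" using \<open>r \<ge> 0\<close> \<open>\<epsilon> > 0\<close> by (simp add: field_simps)
      finally show ?thesis .
    qed
    then show "\<exists>M. \<forall>m\<ge>M. \<forall>n\<ge>M. dist (\<sigma> m s) (\<sigma> n s) < \<epsilon>" by blast
  qed
  then obtain f where f: "\<And>s. (\<lambda>n. \<sigma> n s) \<longlonglongrightarrow> f s"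
    unfolding convergent_def by metis
  have tail: "(\<lambda>s. \<sigma> m s - f s) \<in> D \<and> nrm (\<lambda>s. \<sigma> m s - f s) \<le> \<epsilon>"
    if \<epsilon>: "\<epsilon> > 0" "\<And>n. n \<ge> N \<Longrightarrow> nrm (\<lambda>s. \<sigma> m s - \<sigma> n s) < \<epsilon>" for m \<epsilon> N
  proof -
    have "cmod (pairing c (\<lambda>s. \<sigma> m s - f s)) \<le> \<epsilon> * sqrt (Q c)" for c
    proof (rule LIMSEQ_le_const2)
      show "(\<lambda>n. cmod (pairing c (\<lambda>s. \<sigma> m s - \<sigma> n s))) \<longlonglongrightarrow> cmod (pairing c (\<lambda>s. \<sigma> m s - f s))"
        by (intro tendsto_norm tendsto_pairing tendsto_intros f)
      have "cmod (pairing c (\<lambda>s. \<sigma> m s - \<sigma> n s)) \<le> \<epsilon> * sqrt (Q c)" if "n \<ge> N" for n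
        using pairing_bound[OF D_diff[OF D[of m] D[of n]], of c] \<epsilon>(2)[OF that]
          mult_right_mono[of "nrm (\<lambda>s. \<sigma> m s - \<sigma> n s)" \<epsilon> "sqrt (Q c)"] by simp
      then show "\<exists>N. \<forall>n\<ge>N. cmod (pairing c (\<lambda>s. \<sigma> m s - \<sigma> n s)) \<le> \<epsilon> * sqrt (Q c)" by blast
    qed
    then show ?thesis using \<epsilon>(1) by (intro conjI D_intro_bound[where m = \<epsilon>]) simp_all
  qed
  obtain N1 where "\<forall>m\<ge>N1. \<forall>n\<ge>N1. nrm (\<lambda>s. \<sigma> m s - \<sigma> n s) < 1" using Cauchy[of 1] by auto
  then have "(\<lambda>s. \<sigma> N1 s - f s) \<in> D" using tail[of 1 N1 N1] by auto
  from D_diff[OF D[of N1] this] have fD: "f \<in> D" by simp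
  have "(\<lambda>n. nrm (\<lambda>s. \<sigma> n s - f s)) \<longlonglongrightarrow> 0"
  proof (rule LIMSEQ_I)
    fix \<epsilon> :: real assume "\<epsilon> > 0"
    then obtain N where N: "\<forall>m\<ge>N. \<forall>n\<ge>N. nrm (\<lambda>s. \<sigma> m s - \<sigma> n s) < \<epsilon> / 2"
      using Cauchy[of "\<epsilon> / 2"] by auto
    have "norm (nrm (\<lambda>s. \<sigma> m s - f s) - 0) < \<epsilon>" if "m \<ge> N" for m
      using tail[of "\<epsilon> / 2" N m] N that \<open>\<epsilon> > 0\<close> nrm_nonneg by fastforce
    then show "\<exists>N. \<forall>n\<ge>N. norm (nrm (\<lambda>s. \<sigma> n s - f s) - 0) < \<epsilon>" by blast
  qed
  then show ?thesis using fD by blast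
qed

end

text \<open>The Hilbert space structure depends on the kernel alone and is therefore established for an
arbitrary choice of the fundamental symmetry \<open>J\<close>.\<close>

definition rkhs :: "('s \<Rightarrow> 's \<Rightarrow> complex) \<Rightarrow> (('s \<Rightarrow> complex) \<Rightarrow> 's \<Rightarrow> complex) \<Rightarrow> ('s \<Rightarrow> complex) krein" where
  "rkhs k J = \<lparr>carrier = pos_kernel.D k, mult = (\<lambda>f g s. f s * g s), one = (\<lambda>s. 1),
     zero = (\<lambda>s. 0), add = (\<lambda>f g s. f s + g s), smult = (\<lambda>c f s. c * f s),
     cinner = pos_kernel.inner k, fsym = J\<rparr>"

definition pull :: "('s \<Rightarrow> 's) \<Rightarrow> ('s \<Rightarrow> complex) \<Rightarrow> 's \<Rightarrow> complex" where
  "pull m f = (\<lambda>s. f (m s))"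

context pos_kernel
begin

lemma rkhs_simps [simp]:
  "carrier (rkhs k J) = D" "\<zero>\<^bsub>rkhs k J\<^esub> = (\<lambda>s. 0)"
  "f \<oplus>\<^bsub>rkhs k J\<^esub> g = (\<lambda>s. f s + g s)" "c \<odot>\<^bsub>rkhs k J\<^esub> f = (\<lambda>s. c * f s)"
  "cinner (rkhs k J) = inner" "fsym (rkhs k J) = J"
  by (simp_all add: rkhs_def)

lemma hnorm_rkhs: "f \<in> D \<Longrightarrow> hnorm (rkhs k J) f = nrm f"
  by (simp add: hnorm_def inner_self nrm_def)

lemma hilbert_space_rkhs: "hilbert_space (rkhs k J)"
proof -
  have neg: "\<exists>y\<in>D. \<forall>s. y s + x s = 0" if "x \<in> D" for x
    using D_uminus[OF that] by force
  have "Module.module complex_ring (rkhs k J)"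
  proof (rule moduleI[OF cring_complex_ring])
    show "abelian_group (rkhs k J)"
      using neg by (intro abelian_groupI) (auto simp: D_add fun_eq_iff)
  qed (auto simp: D_scale algebra_simps)
  then interpret module complex_ring "rkhs k J" .
  have minus: "f \<ominus>\<^bsub>rkhs k J\<^esub> g = (\<lambda>s. f s - g s)" if "g \<in> D" for f g
  proof -
    have "\<ominus>\<^bsub>rkhs k J\<^esub> g = (\<lambda>s. - g s)"
      using that D_uminus[OF that] by (intro M.minus_equality) auto
    then show ?thesis by (simp add: a_minus_def)
  qed
  show ?thesis
  proof
    show "\<exists>f\<in>carrier (rkhs k J). (\<lambda>n. hnorm (rkhs k J) (\<sigma> n \<ominus>\<^bsub>rkhs k J\<^esub> f)) \<longlonglongrightarrow> 0"
      if "\<And>n. \<sigma> n \<in> carrier (rkhs k J)"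
        "\<And>\<epsilon>. \<epsilon> > 0 \<Longrightarrow> \<exists>N. \<forall>m\<ge>N. \<forall>n\<ge>N. hnorm (rkhs k J) (\<sigma> m \<ominus>\<^bsub>rkhs k J\<^esub> \<sigma> n) < \<epsilon>"
      for \<sigma> :: "nat \<Rightarrow> 's \<Rightarrow> complex"
      using complete_D[of \<sigma>] that by (simp add: minus hnorm_rkhs D_diff cong: bex_cong)
  qed (auto simp: inner_add inner_scale inner_self q_zero_imp intro: inner_commute)
qed

lemma reproducing: "f \<in> D \<Longrightarrow> inner (\<lambda>t. k t s) f = f s"
  using inner_K[of f "[(1, s)]"] by (simp add: kernel_comb_simps)

lemma kernel_in_D [simp]: "(\<lambda>t. k t s) \<in> D"
  using K_in_D[of "[(1, s)]"] by (simp add: kernel_comb_simps)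

text \<open>Indices that the kernel does not separate give the same vector \<open>e\<^sub>s\<close>, hence the same
coefficient.\<close>

lemma D_indistinguishable:
  assumes "\<And>t. k t s = k t s'" "f \<in> D"
  shows "f s = f s'"
  using reproducing[OF assms(2), of s] reproducing[OF assms(2), of s'] assms(1) by simp

lemma nrm_K: "nrm (K c) = sqrt (Q c)" by (simp add: nrm_def q_K)

lemma nrm_kernel: "nrm (\<lambda>t. k t s) = sqrt (Re (k s s))"
  using nrm_K[of "[(1, s)]"] by (simp add: kernel_comb_simps Q_def)

lemma D_pull:
  assumes bd: "\<And>c. Q (move_comb m c) \<le> B * Q c" and f: "f \<in> D" and "0 \<le> B"
  shows "pull m f \<in> D" "nrm (pull m f) \<le> sqrt B * nrm f"
proof -
  have "cmod (pairing c (pull m f)) \<le> (sqrt B * nrm f) * sqrt (Q c)" for c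
  proof -
    have "cmod (pairing c (pull m f)) \<le> nrm f * sqrt (Q (move_comb m c))"
      using pairing_bound[OF f, of "move_comb m c"] by (simp add: pull_def pairing_move_comb)
    also have "\<dots> \<le> nrm f * sqrt (B * Q c)" using f by (intro mult_left_mono) (auto simp: bd)
    finally show ?thesis by (simp add: real_sqrt_mult ac_simps)
  qed
  then show "pull m f \<in> D" "nrm (pull m f) \<le> sqrt B * nrm f"
    using assms by (auto intro!: D_intro_bound[where m = "sqrt B * nrm f"])
qed

lemma pull_bounded_ops:
  assumes "\<And>c. Q (move_comb m c) \<le> B * Q c" "0 \<le> B"
  shows "pull m \<in> bounded_ops (rkhs k J) (rkhs k J)"
  using D_pull[OF assms(1) _ assms(2)]
  by (auto simp: bounded_ops_def hnorm_rkhs) (auto simp: pull_def)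

text \<open>By the reproducing property the value of the adjoint at \<open>t\<close> is the inner product of
\<open>e\<^sub>t \<circ> m = e\<^bsub>m' t\<^esub>\<close> with \<open>f\<close>.\<close>

lemma hadj_pull:
  assumes adj: "\<And>s t. k (m s) t = k s (m' t)"
    and bd: "pull m \<in> bounded_ops (rkhs k J) (rkhs k J)" and f: "f \<in> D"
  shows "hadj (rkhs k J) (rkhs k J) (pull m) f = pull m' f"
proof
  fix t
  let ?g = "hadj (rkhs k J) (rkhs k J) (pull m) f"
  have "?g t = inner (\<lambda>s. k s t) ?g"
    using hadj_carrier[OF hilbert_space_rkhs hilbert_space_rkhs bd, of f] f
    by (simp add: reproducing)
  also have "\<dots> = inner (pull m (\<lambda>s. k s t)) f"
    using cinner_hadj_right[OF hilbert_space_rkhs hilbert_space_rkhs bd, of f] f by simp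
  also have "\<dots> = pull m' f t" using f by (simp add: pull_def adj reproducing)
  finally show "?g t = pull m' f t" .
qed

lemma Q_move_isometry:
  assumes "\<And>s t. k (m s) (m t) = k s t"
  shows "Q (move_comb m c) = Q c"
proof -
  have "K (move_comb m c) (m s) = K c s" for s
    by (induction c) (auto simp: kernel_comb_def move_comb_def assms)
  then show ?thesis by (simp add: Q_def pairing_move_comb)
qed

text \<open>The adjoint of the synthesis map that sends \<open>e\<^sub>s\<close> to the vector \<open>e s\<close> of another Hilbert space.\<close>

definition analysis :: "('h, 'm) hilbert_scheme \<Rightarrow> ('s \<Rightarrow> 'h) \<Rightarrow> 'h \<Rightarrow> 's \<Rightarrow> complex" where
  "analysis H e y = (\<lambda>s. cinner H (e s) y)"

text \<open>If the Gram matrix of the family \<open>e\<close> is dominated by the kernel, then the synthesis map is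
bounded; so is its adjoint, and the synthesis map itself is recovered as the adjoint of that
adjoint.\<close>

lemma
  assumes H: "hilbert_space H" and e: "\<And>s. e s \<in> carrier H"
    and bd: "\<And>c. Re (pairing c (kernel_comb (\<lambda>s t. cinner H (e s) (e t)) c)) \<le> B * Q c"
    and B: "0 \<le> B"
  shows analysis_bounded_ops: "analysis H e \<in> bounded_ops H (rkhs k J)"
    and hadj_analysis_kernel: "hadj H (rkhs k J) (analysis H e) (\<lambda>t. k t s) = e s"
proof -
  interpret hilbert_space H by fact
  define comb where "comb c = foldr (\<lambda>(z, s) x. z \<odot>\<^bsub>H\<^esub> e s \<oplus>\<^bsub>H\<^esub> x) c \<zero>\<^bsub>H\<^esub>" for c
  have comb: "comb c \<in> carrier H" for c
    by (induction c) (auto simp: comb_def e)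
  have pair: "pairing c (analysis H e y) = cinner H (comb c) y" if "y \<in> carrier H" for c y
  proof (induction c)
    case (Cons p c)
    then show ?case using comb[of c] that by (cases p) (auto simp: comb_def analysis_def cinner_simps e)
  qed (simp add: comb_def that)
  have gram: "kernel_comb (\<lambda>s t. cinner H (e s) (e t)) c = analysis H e (comb c)" for c
  proof (induction c)
    case (Cons p c)
    then show ?case using comb[of c]
      by (cases p) (auto simp: comb_def analysis_def cinner_simps e kernel_comb_simps fun_eq_iff)
  qed (simp add: kernel_comb_simps comb_def analysis_def e fun_eq_iff)
  have comb_norm: "hnorm H (comb c) \<le> sqrt (B * Q c)" for c
    using bd[of c] comb[of c] by (simp add: gram pair hnorm_def)
  have D: "analysis H e y \<in> D" and nrm: "nrm (analysis H e y) \<le> (sqrt B) * hnorm H y"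
    if y: "y \<in> carrier H" for y
  proof -
    have "cmod (pairing c (analysis H e y)) \<le> (sqrt B * hnorm H y) * sqrt (Q c)" for c
    proof -
      have "cmod (pairing c (analysis H e y)) \<le> hnorm H (comb c) * hnorm H y"
        using Cauchy_Schwarz[OF comb y] by (simp add: pair y)
      also have "\<dots> \<le> sqrt (B * Q c) * hnorm H y"
        using y by (intro mult_right_mono comb_norm) auto
      finally show ?thesis by (simp add: real_sqrt_mult ac_simps)
    qed
    then show "analysis H e y \<in> D" "nrm (analysis H e y) \<le> (sqrt B) * hnorm H y"
      using B y by (auto intro!: D_intro_bound[where m = "sqrt B * hnorm H y"])
  qed
  show bdd: "analysis H e \<in> bounded_ops H (rkhs k J)"
    using D nrm unfolding bounded_ops_def
    by (auto simp: hnorm_rkhs) (auto simp: analysis_def cinner_simps e)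
  show "hadj H (rkhs k J) (analysis H e) (\<lambda>t. k t s) = e s"
    using e D by (intro hadj_eqI H) (auto simp: reproducing, simp add: analysis_def)
qed

end

section \<open>Uniform boundedness and full Hilbert modules\<close>

text \<open>By Baire's theorem one of the closed sets of points at which all \<open>T i\<close> are bounded by \<open>n\<close>
contains a ball; translating the ball to the origin and scaling gives the bound.\<close>

lemma uniform_boundedness:
  fixes T :: "'i \<Rightarrow> 'a::banach \<Rightarrow> 'b::real_normed_vector"
  assumes lin: "\<And>i. i \<in> I \<Longrightarrow> bounded_linear (T i)"
    and pointwise: "\<And>x. \<exists>M. \<forall>i\<in>I. norm (T i x) \<le> M"
  shows "\<exists>C\<ge>0. \<forall>i\<in>I. \<forall>x. norm (T i x) \<le> C * norm x"
proof -
  define F where "F n = {x. \<forall>i\<in>I. norm (T i x) \<le> real n}" for n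
  have cont: "continuous_on UNIV (\<lambda>x. norm (T i x))" if "i \<in> I" for i
    using lin[OF that] by (intro continuous_intros linear_continuous_on)
  have closed: "closed (F n)" for n
  proof -
    have "F n = (\<Inter>i\<in>I. {x. norm (T i x) \<le> real n})" by (auto simp: F_def)
    then show ?thesis
      using cont by (auto intro!: closed_INT closed_Collect_le)
  qed
  have cover: "(\<Union>n. F n) = UNIV"
  proof -
    have "x \<in> (\<Union>n. F n)" for x
    proof -
      obtain M where "\<forall>i\<in>I. norm (T i x) \<le> M" using pointwise by blast
      moreover obtain n where "M \<le> real n" using real_arch_simple by blast
      ultimately have "x \<in> F n" by (auto simp: F_def intro: order_trans)
      then show ?thesis by blast
    qed
    then show ?thesis by blast
  qed
  have "\<exists>n. interior (F n) \<noteq> {}"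
  proof (rule ccontr)
    assume "\<not> ?thesis"
    then have "euclidean interior_of \<Union> (range F) = {}"
      using closed completely_metrizable_space_euclidean by (intro Baire_category_alt) auto
    then show False using cover by simp
  qed
  then obtain n x0 r where r: "r > 0" "cball x0 r \<subseteq> F n"
    by (metis all_not_in_conv mem_interior_cball)
  have bd: "norm (T i x) \<le> (2 * real n / r) * norm x" if i: "i \<in> I" for i x
  proof (cases "x = 0")
    case False
    interpret bounded_linear "T i" using lin[OF i] .
    define y where "y = (r / norm x) *\<^sub>R x"
    \<comment> \<open>\<open>T i y\<close> is the difference of two values on the ball.\<close>
    have "x0 + y \<in> cball x0 r" "x0 \<in> cball x0 r"
      using False r(1) by (auto simp: y_def dist_norm)
    then have "x0 + y \<in> F n" "x0 \<in> F n" using r(2) by blast+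
    then have "norm (T i (x0 + y)) \<le> real n" "norm (T i x0) \<le> real n"
      using i by (simp_all add: F_def)
    then have "norm (T i y) \<le> 2 * real n"
      using norm_triangle_ineq4[of "T i (x0 + y)" "T i x0"] by (simp add: add)
    moreover have "norm (T i y) = (r / norm x) * norm (T i x)"
      using r(1) by (simp add: y_def scale)
    ultimately show ?thesis using False r(1) by (simp add: field_simps)
  next
    case True
    interpret bounded_linear "T i" using lin[OF i] .
    show ?thesis by (simp add: True zero)
  qed
  show ?thesis using bd r(1) by (intro exI[of _ "2 * real n / r"]) auto
qed

text \<open>The span of the inner products is dense, so it contains some \<open>s\<close> at distance less than \<open>1\<close> from
the unit. Such an \<open>s\<close> is invertible: \<open>s y = a\<close> is solved by the fixed point of the contraction
\<open>y \<mapsto> a + (1 - s) y\<close>. As \<open>\<langle>x, z\<rangle> y = \<langle>x, z y\<rangle>\<close>, the element \<open>a = s y\<close> is again a combination of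
inner products, and a linear property of all inner products holds on the whole algebra.\<close>

lemma full_module_induct [consumes 2, case_names zero add scale ip]:
  fixes ip :: "'x::{complex_normed_vector, banach} \<Rightarrow> 'x \<Rightarrow> 'a::unital_cstar_algebra"
  assumes module: "hilbert_cstar_module act ip" and full: "full_ip ip"
    and P0: "P 0" and P_add: "\<And>a b. P a \<Longrightarrow> P b \<Longrightarrow> P (a + b)"
    and P_scale: "\<And>c a. P a \<Longrightarrow> P (c *\<^sub>C a)" and P_ip: "\<And>x y. P (ip x y)"
  shows "P a"
proof -
  interpret hilbert_cstar_module act ip by fact
  interpret C: Modules.module "scaleC :: complex \<Rightarrow> 'a \<Rightarrow> 'a"
    by standard (auto simp: scaleC_add_right scaleC_add_left scaleC_scaleC scaleC_one)
  have "\<exists>s\<in>C.span {ip x y |x y. True}. dist s 1 < 1"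
    using full unfolding full_ip_def by (intro closure_approachable[THEN iffD1, rule_format]) auto
  then obtain s where s: "s \<in> C.span {ip x y |x y. True}" "dist s 1 < 1" by blast
  define f where "f y = a + (1 - s) * y" for y
  have "\<exists>!y. f y = y"
  proof (rule banach_fix_type)
    show "\<forall>x y. dist (f x) (f y) \<le> dist s 1 * dist x y"
    proof (intro allI)
      fix x y
      have "f x - f y = (1 - s) * (x - y)" by (simp add: f_def right_diff_distrib)
      then have "dist (f x) (f y) \<le> norm (1 - s) * norm (x - y)"
        by (simp add: dist_norm norm_mult_ineq)
      then show "dist (f x) (f y) \<le> dist s 1 * dist x y"
        by (simp add: dist_norm norm_minus_commute[of s])
    qed
  qed (use s(2) in auto)
  then obtain y where "f y = y" by blast
  then have sy: "s * y = a" by (simp add: f_def left_diff_distrib)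
  have "P (s * y)" using s(1)
  proof (induction rule: C.span_induct_alt)
    case base
    then show ?case by (simp add: P0)
  next
    case (step c b b')
    then obtain u v where "b = ip u v" by blast
    then have "(c *\<^sub>C b + b') * y = c *\<^sub>C ip u (act v y) + b' * y"
      by (simp add: distrib_right mult_scaleC_left ip_act_right)
    then show ?case using step.IH P_add P_scale P_ip by simp
  qed
  then show ?thesis by (simp add: sy)
qed

section \<open>The dilation of an \<alpha>-completely positive map\<close>

lemma star_one [simp]: "star (1 :: 'a::unital_cstar_algebra) = 1"
  by (metis mult_1_right mult_1_left star_mult star_star)

lemma star_automorphism_one: "star_automorphism \<beta> \<Longrightarrow> \<beta> (1 :: 'a::unital_cstar_algebra) = 1"
  unfolding star_automorphism_def by (metis bij_pointE mult_1_left mult_1_right)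

lemma
  assumes "krein_space H"
  shows krein_hilbert: "hilbert_space H"
    and fsym_carrier: "x \<in> carrier H \<Longrightarrow> fsym H x \<in> carrier H"
    and fsym_fsym: "x \<in> carrier H \<Longrightarrow> fsym H (fsym H x) = x"
    and cinner_fsym: "\<lbrakk>x \<in> carrier H; y \<in> carrier H\<rbrakk> \<Longrightarrow> cinner H (fsym H x) y = cinner H x (fsym H y)"
proof -
  have J: "fsym H \<in> bounded_ops H H" using assms by (simp add: krein_space_def)
  show *: "hilbert_space H" "x \<in> carrier H \<Longrightarrow> fsym H (fsym H x) = x"
    using assms by (auto simp: krein_space_def)
  show "x \<in> carrier H \<Longrightarrow> fsym H x \<in> carrier H" using bounded_opsD(1)[OF J] .
  show "\<lbrakk>x \<in> carrier H; y \<in> carrier H\<rbrakk> \<Longrightarrow> cinner H (fsym H x) y = cinner H x (fsym H y)"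
    using cinner_hadj_left[OF *(1,1) J, of x y] assms by (simp add: krein_space_def)
qed

locale alpha_cp_map =
  fixes \<alpha> :: "'a::unital_cstar_algebra \<Rightarrow> 'a" and H :: "'h krein" and \<phi> :: "'a \<Rightarrow> 'h \<Rightarrow> 'h"
  assumes krein_algebra: "krein_cstar_algebra \<alpha>"
    and krein_H: "krein_space H"
    and cp: "alpha_cp \<alpha> H \<phi>"
begin

sublocale H: hilbert_space H by (rule krein_hilbert[OF krein_H])

lemma alpha_simps [simp]:
  "\<alpha> (a + b) = \<alpha> a + \<alpha> b" "\<alpha> (c *\<^sub>C a) = c *\<^sub>C \<alpha> a" "\<alpha> (a * b) = \<alpha> a * \<alpha> b"
  "\<alpha> (star a) = star (\<alpha> a)" "\<alpha> (\<alpha> a) = a" "\<alpha> 1 = 1"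
  using krein_algebra star_automorphism_one[of \<alpha>]
  by (auto simp: krein_cstar_algebra_def star_automorphism_def)

lemma sharp_simps [simp]:
  "sharp \<alpha> (a + b) = sharp \<alpha> a + sharp \<alpha> b" "sharp \<alpha> (c *\<^sub>C a) = cnj c *\<^sub>C sharp \<alpha> a"
  "sharp \<alpha> (a * b) = sharp \<alpha> b * sharp \<alpha> a" "sharp \<alpha> (sharp \<alpha> a) = a" "sharp \<alpha> 1 = 1"
  "sharp \<alpha> (\<alpha> a) = star a" "star (sharp \<alpha> a) = \<alpha> a" "\<alpha> (sharp \<alpha> a) = star a" "sharp \<alpha> (star a) = \<alpha> a"
  by (simp_all add: sharp_def star_add star_scaleC star_mult star_star flip: alpha_simps(4))

lemma phi_ops: "\<phi> a \<in> bounded_ops H H"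
  using cp by (simp add: alpha_cp_def bounded_linear_into_ops_def)

lemma phi_carrier [simp]: "\<xi> \<in> carrier H \<Longrightarrow> \<phi> a \<xi> \<in> carrier H"
  by (rule bounded_opsD(1)[OF phi_ops])

lemma phi_vector:
  "\<lbrakk>\<xi> \<in> carrier H; \<zeta> \<in> carrier H\<rbrakk> \<Longrightarrow> \<phi> a (\<xi> \<oplus>\<^bsub>H\<^esub> \<zeta>) = \<phi> a \<xi> \<oplus>\<^bsub>H\<^esub> \<phi> a \<zeta>"
  "\<xi> \<in> carrier H \<Longrightarrow> \<phi> a (c \<odot>\<^bsub>H\<^esub> \<xi>) = c \<odot>\<^bsub>H\<^esub> \<phi> a \<xi>"
  using bounded_opsD(2,3)[OF phi_ops] by blast+

lemma phi_linear:
  "\<xi> \<in> carrier H \<Longrightarrow> \<phi> (a + b) \<xi> = \<phi> a \<xi> \<oplus>\<^bsub>H\<^esub> \<phi> b \<xi>"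
  "\<xi> \<in> carrier H \<Longrightarrow> \<phi> (c *\<^sub>C a) \<xi> = c \<odot>\<^bsub>H\<^esub> \<phi> a \<xi>"
  using cp by (auto simp: alpha_cp_def bounded_linear_into_ops_def)

lemma phi_bound:
  obtains C where "C \<ge> 0" "\<And>a \<xi>. \<xi> \<in> carrier H \<Longrightarrow> hnorm H (\<phi> a \<xi>) \<le> C * norm a * hnorm H \<xi>"
proof -
  have "\<exists>C. \<forall>a. \<forall>\<xi>\<in>carrier H. hnorm H (\<phi> a \<xi>) \<le> C * norm a * hnorm H \<xi>"
    using cp unfolding alpha_cp_def bounded_linear_into_ops_def by (elim conjE)
  then obtain C where C: "\<And>a \<xi>. \<xi> \<in> carrier H \<Longrightarrow> hnorm H (\<phi> a \<xi>) \<le> C * norm a * hnorm H \<xi>"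
    by blast
  have "hnorm H (\<phi> a \<xi>) \<le> \<bar>C\<bar> * norm a * hnorm H \<xi>" if "\<xi> \<in> carrier H" for a \<xi>
    using C[OF that, of a] that
    by (smt (verit) H.hnorm_nonneg abs_ge_self mult_right_mono norm_ge_zero)
  then show ?thesis using that[of "\<bar>C\<bar>"] by simp
qed

lemma phi_star: "\<lbrakk>\<xi> \<in> carrier H; \<zeta> \<in> carrier H\<rbrakk> \<Longrightarrow> cinner H \<xi> (\<phi> (star a) \<zeta>) = cinner H (\<phi> a \<xi>) \<zeta>"
  using cinner_hadj_right[OF H.hilbert_space_axioms H.hilbert_space_axioms phi_ops] cp
  by (simp add: alpha_cp_def)

lemma phi_alpha: "\<xi> \<in> carrier H \<Longrightarrow> \<phi> (\<alpha> a) \<xi> = \<phi> a \<xi>"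
  using cp by (simp add: alpha_cp_def)

lemma phi_fsym: "\<xi> \<in> carrier H \<Longrightarrow> \<phi> a (fsym H \<xi>) = fsym H (\<phi> a \<xi>)"
proof -
  assume \<xi>: "\<xi> \<in> carrier H"
  then have "fsym H (\<phi> a (fsym H \<xi>)) = \<phi> a \<xi>" using cp by (simp add: alpha_cp_def)
  then show ?thesis using fsym_fsym[OF krein_H phi_carrier[OF fsym_carrier[OF krein_H \<xi>]]] by metis
qed

text \<open>Pairs \<open>(a, \<xi>)\<close> with \<open>\<xi>\<close> outside the carrier are identified with \<open>a \<otimes> 0\<close>. The kernel is then
positive on the whole type of pairs, and every function in the space vanishes at the
meaningless pairs.\<close>

definition to_carrier :: "'h \<Rightarrow> 'h" where "to_carrier \<xi> = (if \<xi> \<in> carrier H then \<xi> else \<zero>\<^bsub>H\<^esub>)"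

lemma to_carrier_carrier [simp]: "to_carrier \<xi> \<in> carrier H" by (simp add: to_carrier_def)
lemma to_carrier_id [simp]: "\<xi> \<in> carrier H \<Longrightarrow> to_carrier \<xi> = \<xi>" by (simp add: to_carrier_def)

text \<open>The semi-inner product of the elementary tensors \<open>a \<otimes> \<xi>\<close> and \<open>b \<otimes> \<zeta>\<close>.\<close>

definition tensor_kernel :: "'a \<times> 'h \<Rightarrow> 'a \<times> 'h \<Rightarrow> complex" where
  "tensor_kernel s t = cinner H (to_carrier (snd s)) (\<phi> (sharp \<alpha> (fst s) * fst t) (to_carrier (snd t)))"

definition tensor_map :: "('a \<Rightarrow> 'a) \<Rightarrow> ('h \<Rightarrow> 'h) \<Rightarrow> 'a \<times> 'h \<Rightarrow> 'a \<times> 'h" where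
  "tensor_map g T s = (g (fst s), T (to_carrier (snd s)))"

lemma kernel_identity:
  "(\<lambda>s t. tensor_kernel (tensor_map (\<lambda>a. a) (\<lambda>\<xi>. \<xi>) s) (tensor_map (\<lambda>a. a) (\<lambda>\<xi>. \<xi>) t)) = tensor_kernel"
  by (simp add: tensor_kernel_def tensor_map_def fun_eq_iff)

text \<open>Scalar coefficients can be absorbed into the vectors, so the quadratic form of the kernel is
a value of the form of an operator matrix; \<open>g\<close> is the identity for the form itself and \<open>a \<mapsto> b a\<close>
for the form of the combination moved by left multiplication with \<open>b\<close>.\<close>

lemma form_eq:
  "pairing c (kernel_comb (\<lambda>s t. tensor_kernel (tensor_map g (\<lambda>\<xi>. \<xi>) s) (tensor_map g (\<lambda>\<xi>. \<xi>) t)) c)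
    = opmat_form H (length c) (\<lambda>i j. \<phi> (sharp \<alpha> (g (fst (snd (c ! i)))) * g (fst (snd (c ! j)))))
        (\<lambda>i. fst (c ! i) \<odot>\<^bsub>H\<^esub> to_carrier (snd (snd (c ! i))))"
  unfolding pairing_def kernel_comb_def opmat_form_def
  by (simp add: sum_list_sum_nth case_prod_unfold atLeast0LessThan sum_distrib_left
      tensor_kernel_def tensor_map_def H.cinner_simps phi_vector mult.assoc mult.left_commute)

lemma kernel_positive: "0 \<le> Re (pairing c (kernel_comb tensor_kernel c))"
proof (cases "c = []")
  case False
  then have "length c \<ge> 1" by (cases c) auto
  then have "pairing c (kernel_comb tensor_kernel c) \<in> \<real>\<^sub>\<ge>\<^sub>0"
    using cp form_eq[of c "\<lambda>a. a", unfolded kernel_identity]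
    by (auto simp: alpha_cp_def opmat_positive_def)
  then show ?thesis by (simp add: complex_nonneg_Reals_iff)
qed simp

sublocale R: pos_kernel tensor_kernel
proof
  show "tensor_kernel t s = cnj (tensor_kernel s t)" for s t
  proof -
    let ?a = "sharp \<alpha> (fst s) * fst t"
    have "\<alpha> (star ?a) = sharp \<alpha> (fst t) * fst s" by (simp add: star_mult) (simp add: sharp_def)
    then have "tensor_kernel t s = cinner H (to_carrier (snd t)) (\<phi> (star ?a) (to_carrier (snd s)))"
      unfolding tensor_kernel_def by (metis phi_alpha to_carrier_carrier)
    also have "\<dots> = cinner H (\<phi> ?a (to_carrier (snd t))) (to_carrier (snd s))" by (rule phi_star) simp_all
    also have "\<dots> = cnj (tensor_kernel s t)" unfolding tensor_kernel_def by (rule H.cinner_commute) simp_all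
    finally show ?thesis .
  qed
qed (rule kernel_positive)

lemma kernel_tensor_map_adjoint:
  assumes "\<And>a b \<xi> \<zeta>. \<lbrakk>\<xi> \<in> carrier H; \<zeta> \<in> carrier H\<rbrakk> \<Longrightarrow>
      cinner H (T \<xi>) (\<phi> (sharp \<alpha> (g a) * b) \<zeta>) = cinner H \<xi> (\<phi> (sharp \<alpha> a * g' b) (T' \<zeta>))"
    and "\<And>\<xi>. \<xi> \<in> carrier H \<Longrightarrow> T \<xi> \<in> carrier H" "\<And>\<xi>. \<xi> \<in> carrier H \<Longrightarrow> T' \<xi> \<in> carrier H"
  shows "tensor_kernel (tensor_map g T s) t = tensor_kernel s (tensor_map g' T' t)"
  using assms by (simp add: tensor_kernel_def tensor_map_def)

abbreviation lmult :: "'a \<Rightarrow> 'a \<times> 'h \<Rightarrow> 'a \<times> 'h" where "lmult a \<equiv> tensor_map (\<lambda>b. a * b) (\<lambda>\<xi>. \<xi>)"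

text \<open>Because \<open>#\<close> is an involution, left multiplication by \<open>a#\<close> is adjoint to left multiplication by
\<open>a\<close>.\<close>

lemma kernel_lmult: "tensor_kernel (lmult (sharp \<alpha> a) s) t = tensor_kernel s (lmult a t)"
  by (rule kernel_tensor_map_adjoint) (simp_all add: mult.assoc)

lemma pairing_K_lmult:
  "pairing c (R.K (move_comb (lmult a) d)) = pairing (move_comb (lmult (sharp \<alpha> a)) c) (R.K d)"
proof -
  have "R.K (move_comb (lmult a) d) s = R.K d (lmult (sharp \<alpha> a) s)" for s
    by (induction d) (auto simp: kernel_comb_def move_comb_def kernel_lmult)
  then show ?thesis by (simp add: pairing_move_comb cong: pairing_cong)
qed

lemma Q_lmult_bound_pointwise: "\<exists>M>0. \<forall>c. R.Q (move_comb (lmult b) c) \<le> M * R.Q c"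
proof -
  obtain M where M: "M > 0" "\<And>n a. n \<ge> 1 \<Longrightarrow>
      opmat_le H n (\<lambda>i j. \<phi> (sharp \<alpha> (b * a i) * (b * a j)))
          (\<lambda>i j \<xi>. complex_of_real M \<odot>\<^bsub>H\<^esub> \<phi> (sharp \<alpha> (a i) * a j) \<xi>)"
  proof -
    have "\<exists>M>0. \<forall>n\<ge>1. \<forall>a. opmat_le H n (\<lambda>i j. \<phi> (sharp \<alpha> (b * a i) * (b * a j)))
          (\<lambda>i j \<xi>. complex_of_real M \<odot>\<^bsub>H\<^esub> \<phi> (sharp \<alpha> (a i) * a j) \<xi>)"
      using cp unfolding alpha_cp_def by blast
    then show ?thesis using that by blast
  qed
  have "R.Q (move_comb (lmult b) c) \<le> M * R.Q c" for c
  proof (cases "c = []")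
    case False
    let ?n = "length c" and ?a = "\<lambda>i. fst (snd (c ! i))"
    let ?\<xi> = "\<lambda>i. fst (c ! i) \<odot>\<^bsub>H\<^esub> to_carrier (snd (snd (c ! i)))"
    have n: "?n \<ge> 1" using False by (cases c) auto
    have 1: "pairing c (R.K c) = opmat_form H ?n (\<lambda>i j. \<phi> (sharp \<alpha> (?a i) * ?a j)) ?\<xi>"
      by (rule form_eq[of c "\<lambda>a. a", unfolded kernel_identity])
    have 2: "pairing (move_comb (lmult b) c) (R.K (move_comb (lmult b) c))
        = opmat_form H ?n (\<lambda>i j. \<phi> (sharp \<alpha> (b * ?a i) * (b * ?a j))) ?\<xi>"
    proof -
      have "R.K (move_comb (lmult b) c) (lmult b s)
          = kernel_comb (\<lambda>s t. tensor_kernel (lmult b s) (lmult b t)) c s" for s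
        by (induction c) (auto simp: kernel_comb_def move_comb_def)
      then show ?thesis
        using form_eq[of c "\<lambda>a. b * a"] by (simp add: pairing_move_comb)
    qed
    have "opmat_form H ?n (\<lambda>i j \<xi>. (complex_of_real M \<odot>\<^bsub>H\<^esub> \<phi> (sharp \<alpha> (?a i) * ?a j) \<xi>)
        \<ominus>\<^bsub>H\<^esub> \<phi> (sharp \<alpha> (b * ?a i) * (b * ?a j)) \<xi>) ?\<xi> \<in> \<real>\<^sub>\<ge>\<^sub>0"
      using M(2)[OF n, of ?a] unfolding opmat_le_def opmat_positive_def by simp
    also have "opmat_form H ?n (\<lambda>i j \<xi>. (complex_of_real M \<odot>\<^bsub>H\<^esub> \<phi> (sharp \<alpha> (?a i) * ?a j) \<xi>)
        \<ominus>\<^bsub>H\<^esub> \<phi> (sharp \<alpha> (b * ?a i) * (b * ?a j)) \<xi>) ?\<xi>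
      = complex_of_real M * pairing c (R.K c)
        - pairing (move_comb (lmult b) c) (R.K (move_comb (lmult b) c))"
      unfolding 1 2 opmat_form_def sum_distrib_left sum_subtractf[symmetric]
      by (intro sum.cong refl) (simp add: H.cinner_minus_right H.cinner_smult_right)
    finally show ?thesis by (simp add: complex_nonneg_Reals_iff R.Q_def)
  qed (simp add: R.Q_def move_comb_def)
  then show ?thesis using M(1) by blast
qed

lemma pairing_K_bound: "cmod (pairing c (R.K d)) \<le> sqrt (R.Q c) * sqrt (R.Q d)"
  using R.pairing_bound[OF R.K_in_D, of c d] by (simp add: R.nrm_K mult.commute)

lemma bounded_linear_cinner_phi:
  assumes "\<xi> \<in> carrier H" "\<zeta> \<in> carrier H"
  shows "bounded_linear (\<lambda>a. cinner H \<xi> (\<phi> a \<zeta>))"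
proof -
  obtain C where C: "C \<ge> 0" "\<And>a \<xi>. \<xi> \<in> carrier H \<Longrightarrow> hnorm H (\<phi> a \<xi>) \<le> C * norm a * hnorm H \<xi>"
    using phi_bound by blast
  show ?thesis
  proof (rule bounded_linear_intro[where K = "hnorm H \<xi> * (C * hnorm H \<zeta>)"])
    show "norm (cinner H \<xi> (\<phi> a \<zeta>)) \<le> norm a * (hnorm H \<xi> * (C * hnorm H \<zeta>))" for a
    proof -
      have "norm (cinner H \<xi> (\<phi> a \<zeta>)) \<le> hnorm H \<xi> * hnorm H (\<phi> a \<zeta>)"
        using assms by (intro H.Cauchy_Schwarz) auto
      also have "\<dots> \<le> hnorm H \<xi> * (C * norm a * hnorm H \<zeta>)"
        using assms by (intro mult_left_mono C) auto
      finally show ?thesis by (simp add: ac_simps)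
    qed
  qed (use assms in \<open>simp_all add: phi_linear H.cinner_simps scaleR_scaleC scaleR_conv_of_real\<close>)
qed

lemma bounded_linear_pairing_lmult: "bounded_linear (\<lambda>a. pairing c (R.K (move_comb (lmult a) d)))"
proof -
  have K: "bounded_linear (\<lambda>a. R.K (move_comb (lmult a) d) s)" for s
  proof (induction d)
    case Nil
    then show ?case by (simp add: kernel_comb_def move_comb_def bounded_linear_zero)
  next
    case (Cons p d)
    obtain z t where p: "p = (z, t)" by (cases p)
    have "bounded_linear (\<lambda>a. sharp \<alpha> (fst s) * (a * fst t))"
      using bounded_linear_compose[OF bounded_linear_mult_right bounded_linear_mult_left] .
    then have "bounded_linear (\<lambda>a. tensor_kernel s (lmult a t))"
      using bounded_linear_compose[OF bounded_linear_cinner_phi[OF to_carrier_carrier to_carrier_carrier]]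
      by (simp add: tensor_kernel_def tensor_map_def)
    then have "bounded_linear (\<lambda>a. z * tensor_kernel s (lmult a t) + R.K (move_comb (lmult a) d) s)"
      using Cons.IH by (intro bounded_linear_add bounded_linear_const_mult)
    then show ?case by (simp add: p kernel_comb_def move_comb_def)
  qed
  show ?thesis
  proof (induction c)
    case Nil
    then show ?case by (simp add: bounded_linear_zero)
  next
    case (Cons p c)
    then show ?case using K
      by (cases p) (auto intro!: bounded_linear_add bounded_linear_const_mult)
  qed
qed

text \<open>For fixed combinations \<open>c\<close> and \<open>d\<close> the form \<open>\<langle>c, a d\<rangle>\<close> is a finite sum of terms \<open>\<langle>\<xi>, \<phi>(b# a b') \<zeta>\<rangle>\<close>,
hence continuous in \<open>a\<close>; for fixed \<open>a\<close> it is bounded over all normalised \<open>c\<close> and \<open>d\<close> by the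
domination condition in the definition of \<open>\<alpha>\<close>-complete positivity. The uniform boundedness
principle makes the bound linear in \<open>\<parallel>a\<parallel>\<close>.\<close>

lemma lmult_form_bound:
  "\<exists>C\<ge>0. \<forall>a c d. cmod (pairing c (R.K (move_comb (lmult a) d)))
      \<le> C * norm a * (sqrt (R.Q c) * sqrt (R.Q d))"
proof -
  \<comment> \<open>If a combination has length zero, the quotient is zero by convention, and by \<open>point\<close> so is the pairing.\<close>
  define T where "T p a = pairing (fst p) (R.K (move_comb (lmult a) (snd p)))
      / of_real (sqrt (R.Q (fst p)) * sqrt (R.Q (snd p)))" for p a
  have point: "\<exists>M\<ge>0. \<forall>c d. cmod (pairing c (R.K (move_comb (lmult a) d)))
      \<le> M * (sqrt (R.Q c) * sqrt (R.Q d))" for a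
  proof -
    obtain M where M: "M > 0" "\<And>c. R.Q (move_comb (lmult a) c) \<le> M * R.Q c"
      using Q_lmult_bound_pointwise by blast
    have "cmod (pairing c (R.K (move_comb (lmult a) d))) \<le> sqrt M * (sqrt (R.Q c) * sqrt (R.Q d))" for c d
    proof -
      have "cmod (pairing c (R.K (move_comb (lmult a) d)))
          \<le> sqrt (R.Q c) * sqrt (R.Q (move_comb (lmult a) d))" by (rule pairing_K_bound)
      also have "\<dots> \<le> sqrt (R.Q c) * sqrt (M * R.Q d)"
        by (intro mult_left_mono real_sqrt_le_mono M) simp
      finally show ?thesis by (simp add: real_sqrt_mult ac_simps)
    qed
    then show ?thesis using M(1) by (intro exI[of _ "sqrt M"]) simp
  qed
  have "\<exists>C\<ge>0. \<forall>p\<in>UNIV. \<forall>a. norm (T p a) \<le> C * norm a"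
  proof (rule uniform_boundedness)
    show "bounded_linear (T p)" for p
      unfolding T_def
      by (rule bounded_linear_compose[OF bounded_linear_divide bounded_linear_pairing_lmult])
    fix a
    obtain M where M: "M \<ge> 0" "\<And>c d. cmod (pairing c (R.K (move_comb (lmult a) d)))
      \<le> M * (sqrt (R.Q c) * sqrt (R.Q d))" using point by blast
    have "norm (T p a) \<le> M" for p
    proof -
      define w where "w = sqrt (R.Q (fst p)) * sqrt (R.Q (snd p))"
      have "w \<ge> 0" by (simp add: w_def)
      moreover have "cmod (pairing (fst p) (R.K (move_comb (lmult a) (snd p)))) \<le> M * w"
        using M(2) by (simp add: w_def)
      ultimately show ?thesis using M(1)
        by (cases "w = 0") (simp_all add: T_def norm_divide pos_divide_le_eq flip: w_def)
    qed
    then show "\<exists>M. \<forall>p\<in>UNIV. norm (T p a) \<le> M" by blast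
  qed
  then obtain C where C: "C \<ge> 0" "\<And>p a. norm (T p a) \<le> C * norm a" by blast
  have "cmod (pairing c (R.K (move_comb (lmult a) d))) \<le> C * norm a * (sqrt (R.Q c) * sqrt (R.Q d))"
    for a c d
  proof (cases "sqrt (R.Q c) * sqrt (R.Q d) = 0")
    case True
    obtain M where "cmod (pairing c (R.K (move_comb (lmult a) d))) \<le> M * (sqrt (R.Q c) * sqrt (R.Q d))"
      using point by blast
    then show ?thesis by (simp only: True mult_zero_right)
  next
    case False
    then have "sqrt (R.Q c) * sqrt (R.Q d) > 0"
      by (metis R.Q_nonneg less_eq_real_def mult_nonneg_nonneg real_sqrt_ge_zero)
    then show ?thesis using C(2)[of "(c, d)" a]
      by (simp add: T_def norm_divide norm_mult pos_divide_le_eq del: mult_eq_0_iff)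
  qed
  then show ?thesis using C(1) by blast
qed

lemma Q_lmult_bound:
  "\<exists>C\<ge>0. \<forall>a c. R.Q (move_comb (lmult a) c) \<le> (C * norm a)\<^sup>2 * R.Q c \<and>
      R.Q (move_comb (lmult (sharp \<alpha> a)) c) \<le> (C * norm a)\<^sup>2 * R.Q c"
proof -
  obtain C where C: "C \<ge> 0" "\<And>a c d. cmod (pairing c (R.K (move_comb (lmult a) d)))
      \<le> C * norm a * (sqrt (R.Q c) * sqrt (R.Q d))"
    using lmult_form_bound by blast
  have bound: "cmod (pairing c (R.K (move_comb (lmult a) d)))
      \<le> C * norm a * (sqrt (R.Q c) * sqrt (R.Q d))" for c a d by (rule C(2))
  have aux: "x \<le> B\<^sup>2 * y" if "x \<le> B * (sqrt x * sqrt y)" "x \<ge> 0" "y \<ge> 0" "B \<ge> 0" for x y B :: real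
  proof (cases "x = 0")
    case False
    then have "sqrt x > 0" using that by simp
    have "sqrt x * sqrt x \<le> (B * sqrt y) * sqrt x" using that by (simp add: ac_simps)
    then have "sqrt x \<le> B * sqrt y" using \<open>sqrt x > 0\<close> by (rule mult_right_le_imp_le)
    then have "(sqrt x)\<^sup>2 \<le> (B * sqrt y)\<^sup>2" using that by (intro power_mono) auto
    then show ?thesis using that by (simp add: power_mult_distrib)
  qed (use that in simp)
  have Re: "R.Q c \<le> cmod (pairing c (R.K c))" for c
    unfolding R.Q_def by (rule complex_Re_le_cmod)
  show ?thesis
  proof (intro exI[of _ C] conjI allI C(1))
    fix a c
    \<comment> \<open>Both squared lengths are values of the bounded form, with the moved combination as one argument.\<close>
    show "R.Q (move_comb (lmult a) c) \<le> (C * norm a)\<^sup>2 * R.Q c"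
      using order_trans[OF Re bound[of "move_comb (lmult a) c" a c]] C(1) by (intro aux) auto
    have "R.Q (move_comb (lmult (sharp \<alpha> a)) c)
        \<le> cmod (pairing c (R.K (move_comb (lmult a) (move_comb (lmult (sharp \<alpha> a)) c))))"
      using Re[of "move_comb (lmult (sharp \<alpha> a)) c"] by (simp only: pairing_K_lmult)
    also note bound
    finally show "R.Q (move_comb (lmult (sharp \<alpha> a)) c) \<le> (C * norm a)\<^sup>2 * R.Q c"
      using C(1) by (intro aux) (auto simp: ac_simps)
  qed
qed

abbreviation tensor_J :: "'a \<times> 'h \<Rightarrow> 'a \<times> 'h" where "tensor_J \<equiv> tensor_map \<alpha> (fsym H)"
abbreviation R :: "('a \<times> 'h \<Rightarrow> complex) krein" where "R \<equiv> rkhs tensor_kernel (pull tensor_J)"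

text \<open>Left multiplication by \<open>a\<close> on tensors, read off from the coefficients:
\<open>\<langle>b \<otimes> \<xi>, a f\<rangle> = \<langle>a# b \<otimes> \<xi>, f\<rangle>\<close>.\<close>

definition \<pi> :: "'a \<Rightarrow> ('a \<times> 'h \<Rightarrow> complex) \<Rightarrow> 'a \<times> 'h \<Rightarrow> complex" where
  "\<pi> a = pull (lmult (sharp \<alpha> a))"

definition V :: "'h \<Rightarrow> 'a \<times> 'h \<Rightarrow> complex" where "V \<xi> = (\<lambda>t. tensor_kernel t (1, \<xi>))"

lemma fsym_H [simp]:
  "\<xi> \<in> carrier H \<Longrightarrow> fsym H \<xi> \<in> carrier H" "\<xi> \<in> carrier H \<Longrightarrow> fsym H (fsym H \<xi>) = \<xi>"
  by (auto intro: fsym_carrier[OF krein_H] fsym_fsym[OF krein_H])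

lemma D_to_carrier: "f \<in> R.D \<Longrightarrow> f (a, to_carrier \<xi>) = f (a, \<xi>)"
  by (rule R.D_indistinguishable) (simp_all add: tensor_kernel_def)

text \<open>Here both halves of the invariance of \<open>\<phi>\<close> enter: \<open>J\<close> moves past \<open>\<phi>(\<sqdot>)\<close>, and \<open>\<alpha>\<close> may be inserted in
its argument, which exchanges \<open>a*\<close> with \<open>a#\<close>.\<close>

lemma kernel_J: "tensor_kernel (tensor_J s) t = tensor_kernel s (tensor_J t)"
proof (rule kernel_tensor_map_adjoint)
  show "cinner H (fsym H \<xi>) (\<phi> (sharp \<alpha> (\<alpha> a) * b) \<zeta>)
      = cinner H \<xi> (\<phi> (sharp \<alpha> a * \<alpha> b) (fsym H \<zeta>))" if "\<xi> \<in> carrier H" "\<zeta> \<in> carrier H" for a b \<xi> \<zeta>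
  proof -
    have "cinner H (fsym H \<xi>) (\<phi> (star a * b) \<zeta>) = cinner H \<xi> (\<phi> (star a * b) (fsym H \<zeta>))"
      using that by (simp only: cinner_fsym[OF krein_H] phi_fsym phi_carrier)
    also have "\<phi> (star a * b) (fsym H \<zeta>) = \<phi> (\<alpha> (star a * b)) (fsym H \<zeta>)"
      using that by (intro phi_alpha[symmetric]) simp
    also have "\<alpha> (star a * b) = sharp \<alpha> a * \<alpha> b" by (simp only: alpha_simps(3) sharp_def)
    finally show ?thesis by (simp only: sharp_simps(6))
  qed
qed simp_all

lemma tensor_J_tensor_J: "tensor_J (tensor_J s) = (fst s, to_carrier (snd s))" by (simp add: tensor_map_def)

lemma Q_tensor_J: "R.Q (move_comb tensor_J c) = R.Q c"
  by (rule R.Q_move_isometry) (simp add: kernel_J tensor_J_tensor_J, simp add: tensor_kernel_def)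

lemma pull_J_ops: "pull tensor_J \<in> bounded_ops R R"
  by (rule R.pull_bounded_ops[where B = 1]) (simp_all add: Q_tensor_J)

lemma pull_J_D [simp]: "f \<in> R.D \<Longrightarrow> pull tensor_J f \<in> R.D"
  using R.D_pull(1)[of tensor_J 1 f] by (simp add: Q_tensor_J)

lemma pull_J_invol: "f \<in> R.D \<Longrightarrow> pull tensor_J (pull tensor_J f) = f"
  by (auto simp: pull_def tensor_J_tensor_J D_to_carrier fun_eq_iff)

lemma krein_R: "krein_space R"
  unfolding krein_space_def
proof (intro conjI ballI)
  show "hilbert_space R" by (rule R.hilbert_space_rkhs)
  show "fsym R \<in> bounded_ops R R" using pull_J_ops by simp
  fix f assume "f \<in> carrier R"
  then have f: "f \<in> R.D" by simp
  show "hadj R R (fsym R) f = fsym R f" using R.hadj_pull[OF kernel_J pull_J_ops f] by simp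
  show "fsym R (fsym R f) = f" using pull_J_invol[OF f] by simp
qed

lemma pi_ops: "\<pi> a \<in> bounded_ops R R"
proof -
  obtain C where "C \<ge> 0" "\<And>a c. R.Q (move_comb (lmult (sharp \<alpha> a)) c) \<le> (C * norm a)\<^sup>2 * R.Q c"
    using Q_lmult_bound by blast
  then show ?thesis unfolding \<pi>_def by (intro R.pull_bounded_ops[where B = "(C * norm a)\<^sup>2"]) simp_all
qed

lemma pi_D [simp]: "f \<in> R.D \<Longrightarrow> \<pi> a f \<in> R.D"
  using bounded_opsD(1)[OF pi_ops] by simp

lemma pi_bound: "\<exists>C\<ge>0. \<forall>a. \<forall>f\<in>R.D. R.nrm (\<pi> a f) \<le> C * norm a * R.nrm f"
proof -
  obtain C where C: "C \<ge> 0" "\<And>a c. R.Q (move_comb (lmult (sharp \<alpha> a)) c) \<le> (C * norm a)\<^sup>2 * R.Q c"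
    using Q_lmult_bound by blast
  have "R.nrm (\<pi> a f) \<le> C * norm a * R.nrm f" if "f \<in> R.D" for a f
    using R.D_pull(2)[OF C(2) that] C(1) by (simp add: \<pi>_def)
  then show ?thesis using C(1) by blast
qed

lemma pi_star:
  assumes "f \<in> R.D"
  shows "\<pi> (star a) f = kadj R R (\<pi> a) f"
proof -
  have "kadj R R (\<pi> a) f = pull tensor_J (pull (lmult a) (pull tensor_J f))"
    using R.hadj_pull[OF kernel_lmult pi_ops[unfolded \<pi>_def]] assms by (simp add: kadj_def \<pi>_def)
  then show ?thesis by (simp add: \<pi>_def pull_def tensor_map_def fun_eq_iff)
qed

text \<open>Multiplicativity is immediate from the definition. Linearity in \<open>a\<close> holds because each \<open>f\<close> is an
inner product with \<open>(a# b) \<otimes> \<xi>\<close>, and this kernel vector is additive and antilinear in \<open>a\<close>.\<close>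

lemma krein_rep_pi: "krein_rep R \<pi>"
proof -
  obtain C where C: "\<forall>a. \<forall>f\<in>R.D. R.nrm (\<pi> a f) \<le> C * norm a * R.nrm f" using pi_bound by blast
  have "\<pi> (a + b) f = (\<lambda>s. \<pi> a f s + \<pi> b f s)" if f: "f \<in> R.D" for a b f
  proof
    fix s :: "'a \<times> 'h"
    let ?x = "sharp \<alpha> a * fst s" and ?y = "sharp \<alpha> b * fst s"
    have "(\<lambda>t. tensor_kernel t (?x + ?y, \<xi>)) = (\<lambda>t. tensor_kernel t (?x, \<xi>) + tensor_kernel t (?y, \<xi>))" for \<xi>
      by (simp add: tensor_kernel_def distrib_left phi_linear H.cinner_simps)
    then have "f (?x + ?y, \<xi>) = f (?x, \<xi>) + f (?y, \<xi>)" for \<xi>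
      using R.reproducing[OF f, of "(?x + ?y, \<xi>)"] R.reproducing[OF f, of "(?x, \<xi>)"]
        R.reproducing[OF f, of "(?y, \<xi>)"] f
        hilbert_space.cinner_add_left[OF R.hilbert_space_rkhs[of "pull tensor_J"],
          of "\<lambda>t. tensor_kernel t (?x, \<xi>)" "\<lambda>t. tensor_kernel t (?y, \<xi>)" f]
      by simp
    then show "\<pi> (a + b) f s = \<pi> a f s + \<pi> b f s"
      by (simp add: \<pi>_def pull_def tensor_map_def distrib_right)
  qed
  moreover have "\<pi> (c *\<^sub>C a) f = (\<lambda>s. c * \<pi> a f s)" if f: "f \<in> R.D" for a c f
  proof
    fix s :: "'a \<times> 'h"
    let ?x = "sharp \<alpha> a * fst s"
    have "(\<lambda>t. tensor_kernel t (cnj c *\<^sub>C ?x, \<xi>)) = (\<lambda>t. cnj c * tensor_kernel t (?x, \<xi>))" for \<xi>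
      by (simp add: tensor_kernel_def mult_scaleC_right phi_linear H.cinner_simps)
    then have "f (cnj c *\<^sub>C ?x, \<xi>) = c * f (?x, \<xi>)" for \<xi>
      using R.reproducing[OF f, of "(cnj c *\<^sub>C ?x, \<xi>)"] R.reproducing[OF f, of "(?x, \<xi>)"] f
        hilbert_space.cinner_smult_left[OF R.hilbert_space_rkhs[of "pull tensor_J"],
          of "\<lambda>t. tensor_kernel t (?x, \<xi>)" f "cnj c"]
      by simp
    then show "\<pi> (c *\<^sub>C a) f s = c * \<pi> a f s"
      by (simp add: \<pi>_def pull_def tensor_map_def mult_scaleC_left)
  qed
  moreover have "\<pi> (a * b) f = \<pi> a (\<pi> b f)" for a b f
    by (simp add: \<pi>_def pull_def tensor_map_def mult.assoc)
  ultimately show ?thesis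
    using C pi_ops pi_star
    by (auto simp: krein_rep_def bounded_linear_into_ops_def R.hnorm_rkhs)
qed

lemma V_D [simp]: "V \<xi> \<in> R.D" by (simp add: V_def)

lemma V_ops: "V \<in> bounded_ops H R"
proof -
  obtain C where C: "C \<ge> 0" "\<And>a \<xi>. \<xi> \<in> carrier H \<Longrightarrow> hnorm H (\<phi> a \<xi>) \<le> C * norm a * hnorm H \<xi>"
    using phi_bound by blast
  have "R.nrm (V \<xi>) \<le> sqrt (C * norm (1 :: 'a)) * hnorm H \<xi>" if \<xi>: "\<xi> \<in> carrier H" for \<xi>
  proof -
    have "Re (tensor_kernel (1, \<xi>) (1, \<xi>)) \<le> hnorm H \<xi> * hnorm H (\<phi> 1 \<xi>)"
      using \<xi> H.Cauchy_Schwarz[of \<xi> "\<phi> 1 \<xi>"] complex_Re_le_cmod[of "tensor_kernel (1, \<xi>) (1, \<xi>)"]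
      by (simp add: tensor_kernel_def)
    also have "\<dots> \<le> hnorm H \<xi> * (C * norm (1 :: 'a) * hnorm H \<xi>)"
      using \<xi> by (intro mult_left_mono C) auto
    finally have "sqrt (Re (tensor_kernel (1, \<xi>) (1, \<xi>))) \<le> sqrt (C * norm (1 :: 'a) * (hnorm H \<xi>)\<^sup>2)"
      by (simp add: power2_eq_square ac_simps)
    then show ?thesis using \<xi> by (simp add: V_def R.nrm_kernel real_sqrt_mult)
  qed
  then show ?thesis
    unfolding bounded_ops_def
    by (auto simp: R.hnorm_rkhs) (auto simp: V_def tensor_kernel_def phi_vector H.cinner_simps)
qed

lemma cinner_hadj_V: "\<lbrakk>\<xi> \<in> carrier H; f \<in> R.D\<rbrakk> \<Longrightarrow> cinner H \<xi> (hadj H R V f) = f (1, \<xi>)"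
  using cinner_hadj_right[OF H.hilbert_space_axioms R.hilbert_space_rkhs V_ops, of f \<xi>]
  by (simp add: V_def R.reproducing)

text \<open>The reason is \<open>V J\<^sub>1 = J\<^sub>3 V\<close>, which holds because \<open>\<alpha>(1) = 1\<close>.\<close>

lemma kadj_V:
  assumes f: "f \<in> R.D"
  shows "kadj H R V f = hadj H R V f"
proof (rule H.cinner_ext)
  have c: "hadj H R V g \<in> carrier H" if "g \<in> R.D" for g
    using hadj_carrier[OF H.hilbert_space_axioms R.hilbert_space_rkhs V_ops, of g] that by simp
  then show "kadj H R V f \<in> carrier H" "hadj H R V f \<in> carrier H" using f by (auto simp: kadj_def)
  fix \<xi> assume \<xi>: "\<xi> \<in> carrier H"
  then show "cinner H \<xi> (kadj H R V f) = cinner H \<xi> (hadj H R V f)"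
    using f c by (simp add: kadj_def cinner_hadj_V flip: cinner_fsym[OF krein_H])
      (simp add: pull_def tensor_map_def)
qed

lemma pi_V: "\<pi> a (V \<xi>) = (\<lambda>t. tensor_kernel t (a, \<xi>))"
  by (auto simp: \<pi>_def V_def pull_def kernel_lmult fun_eq_iff) (simp add: tensor_kernel_def tensor_map_def)

lemma pi_alpha_V: "\<xi> \<in> carrier H \<Longrightarrow> \<pi> (\<alpha> a) (V \<xi>) = fsym R (\<pi> a (V (fsym H \<xi>)))"
  by (auto simp: pi_V pull_def kernel_J fun_eq_iff) (simp add: tensor_kernel_def tensor_map_def)

lemma phi_dilation:
  assumes "\<xi> \<in> carrier H"
  shows "\<phi> a \<xi> = kadj H R V (\<pi> a (V \<xi>))"
proof (rule H.cinner_ext)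
  show "\<phi> a \<xi> \<in> carrier H" using assms by simp
  show "kadj H R V (\<pi> a (V \<xi>)) \<in> carrier H"
    using hadj_carrier[OF H.hilbert_space_axioms R.hilbert_space_rkhs V_ops] by (simp add: kadj_V)
  fix \<zeta> assume "\<zeta> \<in> carrier H"
  then show "cinner H \<zeta> (\<phi> a \<xi>) = cinner H \<zeta> (kadj H R V (\<pi> a (V \<xi>)))"
    using assms by (simp add: kadj_V cinner_hadj_V) (simp add: pi_V tensor_kernel_def)
qed

end

section \<open>The dilation of a \<phi>-map\<close>

locale phi_map_dilation = alpha_cp_map \<alpha> H \<phi> + X: hilbert_cstar_module act ip
  for \<alpha> :: "'a::unital_cstar_algebra \<Rightarrow> 'a" and H :: "'h krein" and \<phi>
    and act :: "'x::{complex_normed_vector, banach} \<Rightarrow> 'a \<Rightarrow> 'x" and ip +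
  fixes H2 :: "'h2 krein" and \<Phi> :: "'x \<Rightarrow> 'h \<Rightarrow> 'h2"
  assumes krein_H2: "krein_space H2" and fsym_H2: "\<forall>\<xi>\<in>carrier H2. fsym H2 \<xi> = \<xi>"
    and phi_map: "phi_map H H2 ip \<phi> \<Phi>"
begin

sublocale H2: hilbert_space H2 by (rule krein_hilbert[OF krein_H2])

lemma Phi_ops: "\<Phi> x \<in> bounded_ops H H2"
  using phi_map by (simp add: phi_map_def bounded_linear_into_ops_def)

lemma Phi_carrier [simp]: "\<xi> \<in> carrier H \<Longrightarrow> \<Phi> x \<xi> \<in> carrier H2"
  by (rule bounded_opsD(1)[OF Phi_ops])

lemma Phi_linear:
  "\<xi> \<in> carrier H \<Longrightarrow> \<Phi> (x + y) \<xi> = \<Phi> x \<xi> \<oplus>\<^bsub>H2\<^esub> \<Phi> y \<xi>"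
  "\<xi> \<in> carrier H \<Longrightarrow> \<Phi> (c *\<^sub>C x) \<xi> = c \<odot>\<^bsub>H2\<^esub> \<Phi> x \<xi>"
  using phi_map by (auto simp: phi_map_def bounded_linear_into_ops_def)

lemma phi_ip:
  assumes "\<xi> \<in> carrier H" "\<zeta> \<in> carrier H"
  shows "cinner H \<xi> (\<phi> (ip x y) \<zeta>) = cinner H2 (\<Phi> x (fsym H \<xi>)) (\<Phi> y \<zeta>)"
proof -
  let ?w = "hadj H H2 (\<Phi> x) (\<Phi> y \<zeta>)"
  have w: "?w \<in> carrier H"
    using hadj_carrier[OF H.hilbert_space_axioms H2.hilbert_space_axioms Phi_ops] assms by simp
  have "\<phi> (ip x y) \<zeta> = kadj H H2 (\<Phi> x) (\<Phi> y \<zeta>)"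
    using phi_map assms by (simp add: phi_map_def)
  then have "cinner H \<xi> (\<phi> (ip x y) \<zeta>) = cinner H \<xi> (fsym H ?w)"
    using assms fsym_H2 by (simp add: kadj_def)
  also have "\<dots> = cinner H (fsym H \<xi>) ?w" using cinner_fsym[OF krein_H assms(1) w] by simp
  also have "\<dots> = cinner H2 (\<Phi> x (fsym H \<xi>)) (\<Phi> y \<zeta>)"
    using cinner_hadj_right[OF H.hilbert_space_axioms H2.hilbert_space_axioms Phi_ops] assms by simp
  finally show ?thesis .
qed

lemma ip_act_left: "ip (act x a) y = star a * ip x y"
  by (metis X.ip_act_right X.ip_star star_mult)

lemma ip_diff_right: "ip z (x - y) = ip z x - ip z y"
  using X.ip_add_right[of z "x - y" y] by simp

lemma eq_if_ip_eq:
  assumes "\<And>z. ip z x = ip z y"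
  shows "x = y"
  using X.ip_definite[of "x - y"] assms by (simp add: ip_diff_right)

lemma act_one [simp]: "act x 1 = x"
  by (rule eq_if_ip_eq) (simp add: X.ip_act_right)

text \<open>The image \<open>\<Phi>(x a) \<xi>\<close> that \<open>\<pi>\<^sub>X(x)\<close> assigns to the elementary tensor \<open>a \<otimes> \<xi>\<close>.\<close>

definition Phi_tensor :: "'x \<Rightarrow> 'a \<times> 'h \<Rightarrow> 'h2" where
  "Phi_tensor x s = \<Phi> (act x (fst s)) (to_carrier (snd s))"

lemma Phi_tensor_carrier [simp]: "Phi_tensor x s \<in> carrier H2" by (simp add: Phi_tensor_def)

abbreviation cross :: "'a \<Rightarrow> 'a \<times> 'h \<Rightarrow> 'a \<times> 'h" where
  "cross a \<equiv> tensor_map (\<lambda>b. \<alpha> (a * b)) (fsym H)"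

text \<open>The Gram matrix of the vectors \<open>\<Phi>(x a) \<xi>\<close> is the kernel with \<open>J\<^sub>3 \<pi>(\<langle>x, y\<rangle>)\<close> inserted: the \<phi>-map
relation gives \<open>\<langle>J\<^sub>1 \<xi>, \<phi>(a* \<langle>x, y\<rangle> b) \<zeta>\<rangle>\<close>, and \<open>J\<^sub>1\<close> and \<open>\<alpha>\<close> are then moved as for \<open>J\<^sub>3\<close> itself.\<close>

lemma cinner_Phi_tensor: "cinner H2 (Phi_tensor x s) (Phi_tensor y t) = tensor_kernel s (cross (ip x y) t)"
proof -
  let ?\<xi> = "to_carrier (snd s)" and ?\<zeta> = "to_carrier (snd t)"
  let ?a = "star (fst s) * ip x y * fst t"
  have "cinner H2 (Phi_tensor x s) (Phi_tensor y t) = cinner H (fsym H ?\<xi>) (\<phi> ?a ?\<zeta>)"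
    using phi_ip[of "fsym H ?\<xi>" ?\<zeta> "act x (fst s)" "act y (fst t)"]
    by (simp add: Phi_tensor_def ip_act_left X.ip_act_right mult.assoc)
  also have "\<dots> = cinner H ?\<xi> (\<phi> ?a (fsym H ?\<zeta>))"
    by (simp add: cinner_fsym[OF krein_H] phi_fsym)
  also have "\<phi> ?a (fsym H ?\<zeta>) = \<phi> (\<alpha> ?a) (fsym H ?\<zeta>)" by (rule phi_alpha[symmetric]) simp
  also have "\<alpha> ?a = sharp \<alpha> (fst s) * \<alpha> (ip x y * fst t)"
    by (simp only: alpha_simps(3) sharp_def mult.assoc)
  finally show ?thesis by (simp add: tensor_kernel_def tensor_map_def)
qed

abbreviation Phi_coeff :: "'x \<Rightarrow> 'h2 \<Rightarrow> 'a \<times> 'h \<Rightarrow> complex" where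
  "Phi_coeff x \<equiv> R.analysis H2 (Phi_tensor x)"

lemma
  shows Phi_coeff_ops: "Phi_coeff x \<in> bounded_ops H2 R"
    and hadj_Phi_coeff_kernel: "hadj H2 R (Phi_coeff x) (\<lambda>t. tensor_kernel t s) = Phi_tensor x s"
proof -
  obtain C where C: "C \<ge> 0" "\<And>a c. R.Q (move_comb (lmult a) c) \<le> (C * norm a)\<^sup>2 * R.Q c"
    using Q_lmult_bound by blast
  have bd: "Re (pairing c (kernel_comb (\<lambda>s t. cinner H2 (Phi_tensor x s) (Phi_tensor x t)) c))
      \<le> (C * norm (ip x x)) * R.Q c" for c
  proof -
    let ?d = "move_comb (lmult (ip x x)) c"
    have "kernel_comb (\<lambda>s t. cinner H2 (Phi_tensor x s) (Phi_tensor x t)) c = R.K (move_comb tensor_J ?d)"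
      by (rule ext) (simp add: kernel_comb_def move_comb_def cinner_Phi_tensor tensor_map_def comp_def
          case_prod_unfold)
    then have "Re (pairing c (kernel_comb (\<lambda>s t. cinner H2 (Phi_tensor x s) (Phi_tensor x t)) c))
        \<le> sqrt (R.Q c) * sqrt (R.Q (move_comb tensor_J ?d))"
      using order_trans[OF complex_Re_le_cmod pairing_K_bound] by simp
    also have "\<dots> \<le> sqrt (R.Q c) * sqrt ((C * norm (ip x x))\<^sup>2 * R.Q c)"
      unfolding Q_tensor_J by (intro mult_left_mono real_sqrt_le_mono C) simp
    also have "\<dots> = (C * norm (ip x x)) * R.Q c"
      using C(1) by (simp add: real_sqrt_mult)
    finally show ?thesis .
  qed
  show "Phi_coeff x \<in> bounded_ops H2 R"
    by (rule R.analysis_bounded_ops[OF H2.hilbert_space_axioms Phi_tensor_carrier bd]) (simp add: C(1))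
  show "hadj H2 R (Phi_coeff x) (\<lambda>t. tensor_kernel t s) = Phi_tensor x s"
    by (rule R.hadj_analysis_kernel[OF H2.hilbert_space_axioms Phi_tensor_carrier bd]) (simp add: C(1))
qed

lemma Phi_coeff_D [simp]: "y \<in> carrier H2 \<Longrightarrow> Phi_coeff x y \<in> R.D"
  using bounded_opsD(1)[OF Phi_coeff_ops] by simp

definition \<pi>X :: "'x \<Rightarrow> ('a \<times> 'h \<Rightarrow> complex) \<Rightarrow> 'h2" where "\<pi>X x = hadj H2 R (Phi_coeff x)"

lemma piX_ops: "\<pi>X x \<in> bounded_ops R H2"
  unfolding \<pi>X_def by (rule hadj_bounded_ops[OF H2.hilbert_space_axioms R.hilbert_space_rkhs Phi_coeff_ops])

lemma piX_carrier [simp]: "f \<in> R.D \<Longrightarrow> \<pi>X x f \<in> carrier H2"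
  using bounded_opsD(1)[OF piX_ops] by simp

lemma cinner_piX: "\<lbrakk>y \<in> carrier H2; f \<in> R.D\<rbrakk> \<Longrightarrow> cinner H2 y (\<pi>X x f) = R.inner (Phi_coeff x y) f"
  unfolding \<pi>X_def
  using cinner_hadj_right[OF H2.hilbert_space_axioms R.hilbert_space_rkhs[of "pull tensor_J"] Phi_coeff_ops,
      of f y] by simp

lemma hadj_piX: "y \<in> carrier H2 \<Longrightarrow> hadj R H2 (\<pi>X x) y = Phi_coeff x y"
  unfolding \<pi>X_def by (rule hadj_hadj[OF H2.hilbert_space_axioms R.hilbert_space_rkhs Phi_coeff_ops])

text \<open>The composite \<open>\<pi>\<^sub>X(x)* \<pi>\<^sub>X(y)\<close>, computed on coefficients from the Gram matrix.\<close>

lemma Phi_coeff_piX: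
  assumes f: "f \<in> R.D"
  shows "Phi_coeff x (\<pi>X y f) = pull (cross (ip y x)) f"
proof
  fix s
  have "Phi_coeff x (\<pi>X y f) s = R.inner (Phi_coeff y (Phi_tensor x s)) f"
    using f by (simp add: R.analysis_def cinner_piX)
  also have "Phi_coeff y (Phi_tensor x s) = (\<lambda>t. tensor_kernel t (cross (ip y x) s))"
    by (simp add: R.analysis_def cinner_Phi_tensor fun_eq_iff)
  finally show "Phi_coeff x (\<pi>X y f) s = pull (cross (ip y x)) f s"
    using f by (simp add: R.reproducing pull_def)
qed

lemma piX_ip:
  assumes "f \<in> R.D"
  shows "kadj R H2 (\<pi>X x) (\<pi>X y f) = \<pi> (ip x y) f"
proof -
  have "kadj R H2 (\<pi>X x) (\<pi>X y f) = pull tensor_J (pull (cross (ip y x)) f)"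
    using assms fsym_H2 by (simp add: kadj_def hadj_piX Phi_coeff_piX)
  also have "\<dots> = \<pi> (ip x y) f"
    by (simp add: \<pi>_def pull_def tensor_map_def sharp_def X.ip_star fun_eq_iff del: alpha_simps(4))
  finally show ?thesis .
qed

lemma piX_linear:
  assumes f: "f \<in> R.D"
  shows "\<pi>X (x + y) f = \<pi>X x f \<oplus>\<^bsub>H2\<^esub> \<pi>X y f" and "\<pi>X (c *\<^sub>C x) f = c \<odot>\<^bsub>H2\<^esub> \<pi>X x f"
proof -
  note RH = R.hilbert_space_rkhs[of "pull tensor_J"]
  show "\<pi>X (x + y) f = \<pi>X x f \<oplus>\<^bsub>H2\<^esub> \<pi>X y f"
  proof (rule H2.cinner_ext)
    fix z assume z: "z \<in> carrier H2"
    have "Phi_coeff (x + y) z = (\<lambda>s. Phi_coeff x z s + Phi_coeff y z s)"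
      using z by (simp add: R.analysis_def Phi_tensor_def X.act_add_left Phi_linear H2.cinner_simps
          fun_eq_iff)
    then show "cinner H2 z (\<pi>X (x + y) f) = cinner H2 z (\<pi>X x f \<oplus>\<^bsub>H2\<^esub> \<pi>X y f)"
      using z f hilbert_space.cinner_add_left[OF RH, of "Phi_coeff x z" "Phi_coeff y z" f]
      by (simp add: cinner_piX H2.cinner_simps)
  qed (use f in simp_all)
  show "\<pi>X (c *\<^sub>C x) f = c \<odot>\<^bsub>H2\<^esub> \<pi>X x f"
  proof (rule H2.cinner_ext)
    fix z assume z: "z \<in> carrier H2"
    have "Phi_coeff (c *\<^sub>C x) z = (\<lambda>s. cnj c * Phi_coeff x z s)"
      using z by (simp add: R.analysis_def Phi_tensor_def X.act_scaleC_left Phi_linear H2.cinner_simps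
          fun_eq_iff)
    then show "cinner H2 z (\<pi>X (c *\<^sub>C x) f) = cinner H2 z (c \<odot>\<^bsub>H2\<^esub> \<pi>X x f)"
      using z f hilbert_space.cinner_smult_left[OF RH, of "Phi_coeff x z" f "cnj c"]
      by (simp add: cinner_piX H2.cinner_simps)
  qed (use f in simp_all)
qed

text \<open>By the module relation \<open>\<parallel>\<pi>\<^sub>X(x) f\<parallel>\<^sup>2 = \<langle>J\<^sub>3 \<pi>(\<langle>x, x\<rangle>) f, f\<rangle>\<close>, and \<open>\<parallel>\<langle>x, x\<rangle>\<parallel> = \<parallel>x\<parallel>\<^sup>2\<close>; so the
constant for \<open>\<pi>\<^sub>X\<close> is the square root of the one for \<open>\<pi>\<close>.\<close>

lemma piX_bound: "\<exists>C. \<forall>x. \<forall>f\<in>R.D. hnorm H2 (\<pi>X x f) \<le> C * norm x * R.nrm f"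
proof -
  note RH = R.hilbert_space_rkhs[of "pull tensor_J"]
  obtain C where C: "C \<ge> 0" "\<And>a f. f \<in> R.D \<Longrightarrow> R.nrm (\<pi> a f) \<le> C * norm a * R.nrm f"
    using pi_bound by blast
  have "hnorm H2 (\<pi>X x f) \<le> sqrt C * norm x * R.nrm f" if f: "f \<in> R.D" for x f
  proof -
    have AD: "Phi_coeff x (\<pi>X x f) \<in> R.D" using f by simp
    have "pull tensor_J (Phi_coeff x (\<pi>X x f)) = \<pi> (ip x x) f"
      using piX_ip[OF f, of x x] f fsym_H2 by (simp add: kadj_def hadj_piX)
    then have coeff_eq: "Phi_coeff x (\<pi>X x f) = pull tensor_J (\<pi> (ip x x) f)"
      using pull_J_invol[OF AD] by simp
    have "R.nrm (Phi_coeff x (\<pi>X x f)) \<le> R.nrm (\<pi> (ip x x) f)"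
      using R.D_pull(2)[of tensor_J 1 "\<pi> (ip x x) f"] f by (simp add: coeff_eq Q_tensor_J)
    also have "\<dots> \<le> C * (norm x)\<^sup>2 * R.nrm f" using C(2)[OF f, of "ip x x"] by (simp add: X.norm_ip)
    finally have le: "R.nrm (Phi_coeff x (\<pi>X x f)) \<le> C * (norm x)\<^sup>2 * R.nrm f" .
    have "(hnorm H2 (\<pi>X x f))\<^sup>2 = Re (R.inner (Phi_coeff x (\<pi>X x f)) f)"
      using f by (simp add: H2.hnorm_square cinner_piX)
    also have "\<dots> \<le> R.nrm (Phi_coeff x (\<pi>X x f)) * R.nrm f"
      using hilbert_space.Cauchy_Schwarz[OF RH, of "Phi_coeff x (\<pi>X x f)" f] f
        complex_Re_le_cmod[of "R.inner (Phi_coeff x (\<pi>X x f)) f"]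
      by (simp add: R.hnorm_rkhs)
    also have "\<dots> \<le> C * (norm x)\<^sup>2 * R.nrm f * R.nrm f"
      using f by (intro mult_right_mono le) simp
    finally have "hnorm H2 (\<pi>X x f) \<le> sqrt (C * (norm x)\<^sup>2 * R.nrm f * R.nrm f)"
      by (rule real_le_rsqrt)
    also have "\<dots> = sqrt C * norm x * R.nrm f"
      using f C(1) by (simp add: real_sqrt_mult)
    finally show ?thesis .
  qed
  then show ?thesis by blast
qed

lemma module_rep_piX: "module_rep R H2 ip \<pi> \<pi>X"
proof -
  obtain C where C: "\<And>x f. f \<in> R.D \<Longrightarrow> hnorm H2 (\<pi>X x f) \<le> C * norm x * R.nrm f"
    using piX_bound by blast
  show ?thesis
    unfolding module_rep_def bounded_linear_into_ops_def
    using krein_rep_pi piX_ops by (auto simp: piX_linear piX_ip R.hnorm_rkhs intro: C)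
qed

lemma piX_V: "\<xi> \<in> carrier H \<Longrightarrow> \<pi>X x (V \<xi>) = \<Phi> x \<xi>"
  by (simp add: \<pi>X_def V_def hadj_Phi_coeff_kernel Phi_tensor_def)

end

section \<open>Covariance\<close>

locale covariant_dilation = phi_map_dilation \<alpha> H \<phi> act ip H2 \<Phi>
  for \<alpha> :: "'a::unital_cstar_algebra \<Rightarrow> 'a" and H :: "'h krein" and \<phi>
    and act :: "'x::{complex_normed_vector, banach} \<Rightarrow> 'a \<Rightarrow> 'x" and ip
    and H2 :: "'h2 krein" and \<Phi> +
  fixes G :: "'g monoid" and T :: "'g topology" and \<eta> :: "'g \<Rightarrow> 'x \<Rightarrow> 'x"
    and u :: "'g \<Rightarrow> 'h \<Rightarrow> 'h" and u' :: "'g \<Rightarrow> 'h2 \<Rightarrow> 'h2"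
  assumes full: "full_ip ip" and group_G: "Group.group G"
    and action: "module_action G T ip \<eta>"
    and u: "pseudo_unitary_rep G H u" and u_unitary: "\<forall>t\<in>carrier G. unitary_op H (u t)"
    and u': "pseudo_unitary_rep G H2 u'"
    and cov: "covariant_phi_map G H \<alpha> ip \<Phi> \<eta> u' u"
begin

sublocale G: group G by (rule group_G)

abbreviation \<beta> :: "'g \<Rightarrow> 'a \<Rightarrow> 'a" where "\<beta> \<equiv> induced_action ip \<eta>"

text \<open>This makes the description of the induced action unique, and it yields all its algebraic
laws.\<close>

lemma star_automorphism_eqI:
  assumes "star_automorphism \<beta>1" "star_automorphism \<beta>2" "\<And>x y. \<beta>1 (ip x y) = \<beta>2 (ip x y)"
  shows "\<beta>1 = \<beta>2"
proof
  fix a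
  have zero: "\<gamma> 0 = 0" if "star_automorphism \<gamma>" for \<gamma> :: "'a \<Rightarrow> 'a"
    using that unfolding star_automorphism_def by (metis add_cancel_right_left)
  show "\<beta>1 a = \<beta>2 a"
    using X.hilbert_cstar_module_axioms full
    by (induction a rule: full_module_induct)
      (use assms zero[OF assms(1)] zero[OF assms(2)] in \<open>simp_all add: star_automorphism_def\<close>)
qed

lemma
  assumes t: "t \<in> carrier G"
  shows beta_automorphism: "star_automorphism (\<beta> t)"
    and beta_ip: "\<beta> t (ip x y) = ip (\<eta> t x) (\<eta> t y)"
proof -
  have "hilbert_module_iso ip (\<eta> t)" using action t by (simp add: module_action_def)
  then obtain \<gamma> where \<gamma>: "star_automorphism \<gamma>" "\<forall>x y. ip (\<eta> t x) (\<eta> t y) = \<gamma> (ip x y)"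
    by (auto simp: hilbert_module_iso_def)
  have "\<exists>!\<beta>. star_automorphism \<beta> \<and> (\<forall>x y. \<beta> (ip x y) = ip (\<eta> t x) (\<eta> t y))"
    using \<gamma> by (intro ex1I[of _ \<gamma>]) (auto intro!: star_automorphism_eqI)
  from theI'[OF this] show "star_automorphism (\<beta> t)" "\<beta> t (ip x y) = ip (\<eta> t x) (\<eta> t y)"
    by (auto simp: induced_action_def)
qed

lemma eta_surj: "t \<in> carrier G \<Longrightarrow> \<exists>y. x = \<eta> t y"
  using action unfolding module_action_def hilbert_module_iso_def by (metis bij_pointE)

lemma eta_mult: "\<lbrakk>s \<in> carrier G; t \<in> carrier G\<rbrakk> \<Longrightarrow> \<eta> (s \<otimes>\<^bsub>G\<^esub> t) x = \<eta> s (\<eta> t x)"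
  using action by (simp add: module_action_def)

lemma eta_one: "\<eta> \<one>\<^bsub>G\<^esub> x = x"
  using eta_surj[of "\<one>\<^bsub>G\<^esub>" x] eta_mult[of "\<one>\<^bsub>G\<^esub>" "\<one>\<^bsub>G\<^esub>"] by auto

lemma beta_simps:
  assumes "t \<in> carrier G"
  shows "\<beta> t (a + b) = \<beta> t a + \<beta> t b" "\<beta> t (c *\<^sub>C a) = c *\<^sub>C \<beta> t a" "\<beta> t (a * b) = \<beta> t a * \<beta> t b"
    "\<beta> t (star a) = star (\<beta> t a)" "\<beta> t 1 = 1" "\<beta> t (\<alpha> a) = \<alpha> (\<beta> t a)"
    "sharp \<alpha> (\<beta> t a) = \<beta> t (sharp \<alpha> a)"
proof -
  show *: "\<beta> t (a + b) = \<beta> t a + \<beta> t b" "\<beta> t (c *\<^sub>C a) = c *\<^sub>C \<beta> t a" "\<beta> t (a * b) = \<beta> t a * \<beta> t b"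
    "\<beta> t (star a) = star (\<beta> t a)" for a b c
    using beta_automorphism[OF assms] by (auto simp: star_automorphism_def)
  show "\<beta> t 1 = 1" by (rule star_automorphism_one[OF beta_automorphism[OF assms]])
  have "\<beta> t \<circ> \<alpha> = \<alpha> \<circ> \<beta> t" using cov assms by (simp add: covariant_phi_map_def)
  then show alpha: "\<beta> t (\<alpha> a) = \<alpha> (\<beta> t a)" for a by (simp add: fun_eq_iff)
  show "sharp \<alpha> (\<beta> t a) = \<beta> t (sharp \<alpha> a)"
    by (simp only: sharp_def alpha *)
qed

lemma beta_mult:
  assumes "s \<in> carrier G" "t \<in> carrier G"
  shows "\<beta> (s \<otimes>\<^bsub>G\<^esub> t) a = \<beta> s (\<beta> t a)"
proof -
  have "\<beta> (s \<otimes>\<^bsub>G\<^esub> t) = (\<lambda>a. \<beta> s (\<beta> t a))"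
  proof (rule star_automorphism_eqI)
    show "star_automorphism (\<lambda>a. \<beta> s (\<beta> t a))"
      using beta_automorphism[OF assms(1)] beta_automorphism[OF assms(2)]
      by (auto simp: star_automorphism_def intro: bij_comp[unfolded comp_def])
  qed (use assms in \<open>auto simp: beta_automorphism beta_ip eta_mult\<close>)
  then show ?thesis by simp
qed

lemma beta_one: "\<beta> \<one>\<^bsub>G\<^esub> a = a"
proof -
  have "\<beta> \<one>\<^bsub>G\<^esub> = (\<lambda>a. a)"
  proof (rule star_automorphism_eqI)
    show "star_automorphism (\<lambda>a :: 'a. a)"
      using bij_id by (simp add: star_automorphism_def id_def)
  qed (auto simp: beta_automorphism beta_ip eta_one)
  then show ?thesis by simp
qed

lemma beta_inv:
  assumes "t \<in> carrier G"
  shows "\<beta> t (\<beta> (inv\<^bsub>G\<^esub> t) a) = a" "\<beta> (inv\<^bsub>G\<^esub> t) (\<beta> t a) = a"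
  using beta_mult[of t "inv\<^bsub>G\<^esub> t" a] beta_mult[of "inv\<^bsub>G\<^esub> t" t a] assms by (simp_all add: beta_one)

lemma eta_act: "t \<in> carrier G \<Longrightarrow> \<eta> t (act x a) = act (\<eta> t x) (\<beta> t a)"
proof (rule eq_if_ip_eq)
  fix z assume t: "t \<in> carrier G"
  obtain w where "z = \<eta> t w" using eta_surj[OF t] by blast
  then show "ip z (\<eta> t (act x a)) = ip z (act (\<eta> t x) (\<beta> t a))"
    using t by (simp add: X.ip_act_right beta_simps flip: beta_ip)
qed

lemma u_ops: "t \<in> carrier G \<Longrightarrow> u t \<in> bounded_ops H H"
  and u_mult: "\<lbrakk>t \<in> carrier G; s \<in> carrier G; \<xi> \<in> carrier H\<rbrakk> \<Longrightarrow> u (t \<otimes>\<^bsub>G\<^esub> s) \<xi> = u t (u s \<xi>)"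
  and u_one: "\<xi> \<in> carrier H \<Longrightarrow> u \<one>\<^bsub>G\<^esub> \<xi> = \<xi>"
  and kadj_u: "\<lbrakk>t \<in> carrier G; \<xi> \<in> carrier H\<rbrakk> \<Longrightarrow> kadj H H (u t) \<xi> = u (inv\<^bsub>G\<^esub> t) \<xi>"
  using u by (simp_all add: pseudo_unitary_rep_def)

lemma u_carrier [simp]: "\<lbrakk>t \<in> carrier G; \<xi> \<in> carrier H\<rbrakk> \<Longrightarrow> u t \<xi> \<in> carrier H"
  by (rule bounded_opsD(1)[OF u_ops])

lemma u_inv:
  assumes "t \<in> carrier G" "\<xi> \<in> carrier H"
  shows "u t (u (inv\<^bsub>G\<^esub> t) \<xi>) = \<xi>" "u (inv\<^bsub>G\<^esub> t) (u t \<xi>) = \<xi>"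
  using u_mult[of t "inv\<^bsub>G\<^esub> t" \<xi>] u_mult[of "inv\<^bsub>G\<^esub> t" t \<xi>] assms by (simp_all add: u_one)

lemma hadj_u:
  assumes "t \<in> carrier G" "\<xi> \<in> carrier H"
  shows "hadj H H (u t) \<xi> = u (inv\<^bsub>G\<^esub> t) \<xi>"
proof -
  have "hadj H H (u t) (u t (u (inv\<^bsub>G\<^esub> t) \<xi>)) = u (inv\<^bsub>G\<^esub> t) \<xi>"
    using u_unitary assms by (simp add: unitary_op_def)
  then show ?thesis using assms by (simp add: u_inv)
qed

lemma cinner_u:
  assumes "t \<in> carrier G" "\<xi> \<in> carrier H" "\<zeta> \<in> carrier H"
  shows "cinner H (u t \<xi>) \<zeta> = cinner H \<xi> (u (inv\<^bsub>G\<^esub> t) \<zeta>)"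
  using cinner_hadj_right[OF H.hilbert_space_axioms H.hilbert_space_axioms u_ops[OF assms(1)] assms(3,2)]
    assms by (simp add: hadj_u)

lemma fsym_u:
  assumes "t \<in> carrier G" "\<xi> \<in> carrier H"
  shows "fsym H (u t \<xi>) = u t (fsym H \<xi>)"
proof -
  let ?s = "inv\<^bsub>G\<^esub> t"
  have "fsym H (u t (fsym H (fsym H \<xi>))) = u t (fsym H \<xi>)"
    using kadj_u[of ?s "fsym H \<xi>"] assms by (simp add: kadj_def hadj_u)
  then show ?thesis using assms by simp
qed

lemma u'_ops: "t \<in> carrier G \<Longrightarrow> u' t \<in> bounded_ops H2 H2"
  and u'_mult: "\<lbrakk>t \<in> carrier G; s \<in> carrier G; y \<in> carrier H2\<rbrakk> \<Longrightarrow> u' (t \<otimes>\<^bsub>G\<^esub> s) y = u' t (u' s y)"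
  and u'_one: "y \<in> carrier H2 \<Longrightarrow> u' \<one>\<^bsub>G\<^esub> y = y"
  and kadj_u': "\<lbrakk>t \<in> carrier G; y \<in> carrier H2\<rbrakk> \<Longrightarrow> kadj H2 H2 (u' t) y = u' (inv\<^bsub>G\<^esub> t) y"
  using u' by (simp_all add: pseudo_unitary_rep_def)

lemma u'_carrier [simp]: "\<lbrakk>t \<in> carrier G; y \<in> carrier H2\<rbrakk> \<Longrightarrow> u' t y \<in> carrier H2"
  by (rule bounded_opsD(1)[OF u'_ops])

lemma kadj_H2:
  assumes "S \<in> bounded_ops H2 H2" "y \<in> carrier H2"
  shows "kadj H2 H2 S y = hadj H2 H2 S y"
  using hadj_carrier[OF H2.hilbert_space_axioms H2.hilbert_space_axioms assms] assms fsym_H2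
  by (simp add: kadj_def)

lemma cinner_u':
  assumes "t \<in> carrier G" "y \<in> carrier H2" "z \<in> carrier H2"
  shows "cinner H2 (u' t y) z = cinner H2 y (u' (inv\<^bsub>G\<^esub> t) z)"
  using cinner_hadj_right[OF H2.hilbert_space_axioms H2.hilbert_space_axioms u'_ops[OF assms(1)] assms(3,2)]
    assms by (simp add: kadj_H2 u'_ops flip: kadj_u')

lemma u'_inv:
  assumes "t \<in> carrier G" "y \<in> carrier H2"
  shows "u' (inv\<^bsub>G\<^esub> t) (u' t y) = y"
  using u'_mult[of "inv\<^bsub>G\<^esub> t" t y] assms by (simp add: u'_one)

lemma Phi_eta:
  assumes "t \<in> carrier G" "\<xi> \<in> carrier H"
  shows "\<Phi> (\<eta> t x) (u t \<xi>) = u' t (\<Phi> x \<xi>)"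
  using cov assms by (simp add: covariant_phi_map_def covariant_rep_def kadj_u u_inv)

text \<open>For \<open>a = \<langle>x, y\<rangle>\<close> this is the covariance of \<open>\<Phi>\<close> together with unitarity of \<open>u'\<close> and \<open>u\<close>, the latter
commuting with \<open>J\<^sub>1\<close>; both sides are linear in \<open>a\<close>, so the inner products suffice.\<close>

lemma phi_beta:
  assumes t: "t \<in> carrier G" and \<xi>: "\<xi> \<in> carrier H"
  shows "\<phi> (\<beta> t a) (u t \<xi>) = u t (\<phi> a \<xi>)"
  using X.hilbert_cstar_module_axioms full
proof (induction a rule: full_module_induct)
  case zero
  have z: "scaleC 0 (0 :: 'a) = 0"
    using scaleC_scaleC[of 0 0 "0 :: 'a"] scaleR_scaleC[of 0 "0 :: 'a"] by simp
  have "\<phi> 0 \<zeta> = \<zero>\<^bsub>H\<^esub>" if "\<zeta> \<in> carrier H" for \<zeta>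
    using phi_linear(2)[OF that, of 0 0] z H.smult_l_null[of "\<phi> 0 \<zeta>"] that by simp
  moreover have "\<beta> t 0 = 0" using beta_simps(1)[OF t, of 0 0] by simp
  moreover have "u t \<zero>\<^bsub>H\<^esub> = \<zero>\<^bsub>H\<^esub>"
    using bounded_opsD(3)[OF u_ops[OF t] H.M.zero_closed, of 0] H.smult_l_null[of "u t \<zero>\<^bsub>H\<^esub>"]
      H.smult_l_null[of "\<zero>\<^bsub>H\<^esub>"] t by simp
  ultimately show ?case using t \<xi> by simp
next
  case (add a b)
  then show ?case using t \<xi> bounded_opsD(2)[OF u_ops[OF t], of "\<phi> a \<xi>" "\<phi> b \<xi>"]
    by (simp add: beta_simps phi_linear)
next
  case (scale c a)
  then show ?case using t \<xi> bounded_opsD(3)[OF u_ops[OF t], of "\<phi> a \<xi>" c]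
    by (simp add: beta_simps phi_linear)
next
  case (ip x y)
  show ?case
  proof (rule H.cinner_ext)
    fix \<zeta> assume \<zeta>: "\<zeta> \<in> carrier H"
    let ?\<zeta> = "u (inv\<^bsub>G\<^esub> t) \<zeta>"
    have "cinner H \<zeta> (\<phi> (\<beta> t (ip x y)) (u t \<xi>)) = cinner H2 (\<Phi> (\<eta> t x) (fsym H \<zeta>)) (\<Phi> (\<eta> t y) (u t \<xi>))"
      using t \<xi> \<zeta> by (simp add: beta_ip phi_ip)
    also have "fsym H \<zeta> = u t (fsym H ?\<zeta>)" using t \<zeta> by (simp add: u_inv flip: fsym_u)
    also have "cinner H2 (\<Phi> (\<eta> t x) (u t (fsym H ?\<zeta>))) (\<Phi> (\<eta> t y) (u t \<xi>))
        = cinner H2 (\<Phi> x (fsym H ?\<zeta>)) (\<Phi> y \<xi>)"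
      using t \<xi> \<zeta> by (simp add: Phi_eta cinner_u' u'_inv)
    also have "\<dots> = cinner H ?\<zeta> (\<phi> (ip x y) \<xi>)" using t \<xi> \<zeta> by (simp add: phi_ip)
    also have "\<dots> = cinner H \<zeta> (u t (\<phi> (ip x y) \<xi>))"
      using t \<xi> \<zeta> by (simp add: cinner_u)
    finally show "cinner H \<zeta> (\<phi> (\<beta> t (ip x y)) (u t \<xi>)) = cinner H \<zeta> (u t (\<phi> (ip x y) \<xi>))" .
  qed (use t \<xi> in simp_all)
qed

abbreviation translate :: "'g \<Rightarrow> 'a \<times> 'h \<Rightarrow> 'a \<times> 'h" where "translate t \<equiv> tensor_map (\<beta> t) (u t)"

text \<open>On kernel vectors \<open>v\<^sub>t\<close> is translation by \<open>t\<close>; being unitary, it acts on coefficients through the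
inverse of \<open>t\<close>.\<close>

definition v :: "'g \<Rightarrow> ('a \<times> 'h \<Rightarrow> complex) \<Rightarrow> 'a \<times> 'h \<Rightarrow> complex" where
  "v t = pull (translate (inv\<^bsub>G\<^esub> t))"

lemma kernel_translate:
  assumes t: "t \<in> carrier G"
  shows "tensor_kernel (translate t s) s' = tensor_kernel s (translate (inv\<^bsub>G\<^esub> t) s')"
proof (rule kernel_tensor_map_adjoint)
  fix a b \<xi> \<zeta> assume \<xi>: "\<xi> \<in> carrier H" and \<zeta>: "\<zeta> \<in> carrier H"
  let ?s = "inv\<^bsub>G\<^esub> t"
  have "cinner H (u t \<xi>) (\<phi> (sharp \<alpha> (\<beta> t a) * b) \<zeta>)
      = cinner H \<xi> (u ?s (\<phi> (sharp \<alpha> (\<beta> t a) * b) \<zeta>))"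
    using t \<xi> \<zeta> by (intro cinner_u) simp_all
  also have "u ?s (\<phi> (sharp \<alpha> (\<beta> t a) * b) \<zeta>) = \<phi> (\<beta> ?s (sharp \<alpha> (\<beta> t a) * b)) (u ?s \<zeta>)"
    using t \<zeta> by (intro phi_beta[symmetric]) simp_all
  also have "\<beta> ?s (sharp \<alpha> (\<beta> t a) * b) = sharp \<alpha> a * \<beta> ?s b"
    using t by (simp add: beta_simps beta_inv)
  finally show "cinner H (u t \<xi>) (\<phi> (sharp \<alpha> (\<beta> t a) * b) \<zeta>)
      = cinner H \<xi> (\<phi> (sharp \<alpha> a * \<beta> ?s b) (u ?s \<zeta>))" .
qed (use t in simp_all)

lemma translate_mult:
  assumes "s \<in> carrier G" "t \<in> carrier G"
  shows "translate (s \<otimes>\<^bsub>G\<^esub> t) p = translate s (translate t p)"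
  using assms by (simp add: tensor_map_def beta_mult u_mult)

lemma translate_one: "translate \<one>\<^bsub>G\<^esub> p = (fst p, to_carrier (snd p))"
  by (simp add: tensor_map_def beta_one u_one)

lemma Q_translate: "t \<in> carrier G \<Longrightarrow> R.Q (move_comb (translate t) c) = R.Q c"
  by (rule R.Q_move_isometry)
    (simp add: kernel_translate flip: translate_mult, simp add: translate_one, simp add: tensor_kernel_def)

lemma v_ops: "t \<in> carrier G \<Longrightarrow> v t \<in> bounded_ops R R"
  unfolding v_def by (rule R.pull_bounded_ops[where B = 1]) (simp_all add: Q_translate)

lemma v_D [simp]: "t \<in> carrier G \<Longrightarrow> f \<in> R.D \<Longrightarrow> v t f \<in> R.D"
  using bounded_opsD(1)[OF v_ops] by simp

lemma hadj_v:
  assumes "t \<in> carrier G" "f \<in> R.D"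
  shows "hadj R R (v t) f = v (inv\<^bsub>G\<^esub> t) f"
  using R.hadj_pull[OF kernel_translate v_ops[unfolded v_def]] assms by (simp add: v_def)

lemma fsym_v:
  assumes "t \<in> carrier G"
  shows "pull tensor_J (v t f) = v t (pull tensor_J f)"
  using assms by (simp add: v_def pull_def tensor_map_def fun_eq_iff beta_simps fsym_u)

lemma kadj_v:
  assumes "t \<in> carrier G" "f \<in> R.D"
  shows "kadj R R (v t) f = hadj R R (v t) f" "kadj R R (v t) f = v (inv\<^bsub>G\<^esub> t) f"
  using assms by (simp_all add: kadj_def hadj_v fsym_v pull_J_invol)

lemma pseudo_unitary_v: "pseudo_unitary_rep G R v"
proof -
  have "v \<one>\<^bsub>G\<^esub> f = f" if "f \<in> R.D" for f
    using that by (simp add: v_def pull_def translate_one D_to_carrier fun_eq_iff)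
  moreover have "v (t \<otimes>\<^bsub>G\<^esub> s) f = v t (v s f)" if "t \<in> carrier G" "s \<in> carrier G" for t s f
    using that by (simp add: v_def pull_def G.inv_mult_group translate_mult)
  ultimately show ?thesis by (simp add: pseudo_unitary_rep_def v_ops kadj_v(2))
qed

lemma V_u:
  assumes "t \<in> carrier G" "\<xi> \<in> carrier H"
  shows "V (u t \<xi>) = v t (V \<xi>)"
proof
  fix s
  have "v t (V \<xi>) s = tensor_kernel s (translate t (1, \<xi>))"
    using kernel_translate[of "inv\<^bsub>G\<^esub> t" s "(1, \<xi>)"] assms by (simp add: v_def V_def pull_def)
  then show "V (u t \<xi>) s = v t (V \<xi>) s"
    using assms by (simp add: V_def tensor_map_def beta_simps)
qed

text \<open>Passing to adjoints, the claim is \<open>v\<^sub>t \<pi>\<^sub>X(x)* u'\<^sub>t* = \<pi>\<^sub>X(\<eta>\<^sub>t x)*\<close>, an identity of coefficient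
functions; it amounts to \<open>u'\<^sub>t \<Phi>(x b) u\<^sub>t* = \<Phi>(\<eta>\<^sub>t(x) \<beta>\<^sub>t(b))\<close>.\<close>

lemma covariant_piX: "covariant_rep G R \<pi>X \<eta> u' v"
  unfolding covariant_rep_def
proof (intro ballI allI)
  fix t x f assume t: "t \<in> carrier G" and "f \<in> carrier R"
  then have f: "f \<in> R.D" by simp
  let ?s = "inv\<^bsub>G\<^esub> t"
  have vf: "v ?s f \<in> R.D" using t f by simp
  have "\<pi>X (\<eta> t x) f = u' t (\<pi>X x (v ?s f))"
  proof (rule H2.cinner_ext)
    fix y assume y: "y \<in> carrier H2"
    have Phi_coeff: "v t (Phi_coeff x (u' ?s y)) = Phi_coeff (\<eta> t x) y"
    proof
      fix p :: "'a \<times> 'h"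
      have "u' t (Phi_tensor x (translate ?s p)) = Phi_tensor (\<eta> t x) p"
        using t by (simp add: Phi_tensor_def tensor_map_def eta_act beta_inv u_inv flip: Phi_eta)
      then show "v t (Phi_coeff x (u' ?s y)) p = Phi_coeff (\<eta> t x) y p"
        using t y by (simp add: v_def pull_def R.analysis_def flip: cinner_u')
    qed
    have "cinner H2 y (\<pi>X (\<eta> t x) f) = R.inner (v t (Phi_coeff x (u' ?s y))) f"
      using y f by (simp add: cinner_piX Phi_coeff)
    also have "\<dots> = R.inner (Phi_coeff x (u' ?s y)) (v ?s f)"
      using cinner_hadj_right[OF R.hilbert_space_rkhs[of "pull tensor_J"]
          R.hilbert_space_rkhs[of "pull tensor_J"] v_ops[OF t], of f "Phi_coeff x (u' ?s y)"] t y f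
      by (simp add: hadj_v)
    also have "\<dots> = cinner H2 (u' ?s y) (\<pi>X x (v ?s f))" using t y vf by (simp add: cinner_piX)
    also have "\<dots> = cinner H2 y (u' t (\<pi>X x (v ?s f)))" using t y vf by (simp add: cinner_u')
    finally show "cinner H2 y (\<pi>X (\<eta> t x) f) = cinner H2 y (u' t (\<pi>X x (v ?s f)))" .
  qed (use t f vf in simp_all)
  then show "\<pi>X (\<eta> t x) f = u' t (\<pi>X x (kadj R R (v t) f))" using t f by (simp add: kadj_v(2))
qed

end

lemma
  assumes "hilbert_space H"
  shows id_bounded_ops: "(\<lambda>x. x) \<in> bounded_ops H H"
    and hadj_id: "y \<in> carrier H \<Longrightarrow> hadj H H (\<lambda>x. x) y = y"
  using assms by (auto simp: bounded_ops_def intro: exI[of _ 1] hadj_eqI)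

theorem theorem3p4:
  fixes \<alpha> :: "'a::unital_cstar_algebra \<Rightarrow> 'a"
    and act :: "'x::{complex_normed_vector, banach} \<Rightarrow> 'a \<Rightarrow> 'x"
    and ip :: "'x \<Rightarrow> 'x \<Rightarrow> 'a"
    and G :: "'g monoid"
    and T :: "'g topology"
    and \<eta> :: "'g \<Rightarrow> 'x \<Rightarrow> 'x"
    and H1 :: "'h1 krein"
    and H2 :: "'h2 krein"
    and u :: "'g \<Rightarrow> 'h1 \<Rightarrow> 'h1"
    and u' :: "'g \<Rightarrow> 'h2 \<Rightarrow> 'h2"
    and \<phi> :: "'a \<Rightarrow> 'h1 \<Rightarrow> 'h1"
    and \<Phi> :: "'x \<Rightarrow> 'h1 \<Rightarrow> 'h2"
  assumes "krein_cstar_algebra \<alpha>"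
    and "hilbert_cstar_module act ip" and "full_ip ip"
    and "locally_compact_group G T"
    and "module_action G T ip \<eta>"
    and "krein_space H1"
    and "krein_space H2" and "\<forall>\<xi>\<in>carrier H2. fsym H2 \<xi> = \<xi>"
    and "pseudo_unitary_rep G H1 u" and "\<forall>t\<in>carrier G. unitary_op H1 (u t)"
    and "pseudo_unitary_rep G H2 u'"
    and "alpha_cp \<alpha> H1 \<phi>"
    and "phi_map H1 H2 ip \<phi> \<Phi>"
    and "covariant_phi_map G H1 \<alpha> ip \<Phi> \<eta> u' u"
  shows "\<exists>(K1 :: ('a \<times> 'h1 \<Rightarrow> complex) krein) (K2 :: 'h2 krein) v v' \<pi> \<pi>X V W.
    krein_space K1 \<and> krein_space K2 \<and>
    pseudo_unitary_rep G K1 v \<and> pseudo_unitary_rep G K2 v' \<and>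
    krein_rep K1 \<pi> \<and>
    module_rep K1 K2 ip \<pi> \<pi>X \<and> covariant_rep G K1 \<pi>X \<eta> v' v \<and>
    V \<in> bounded_ops H1 K1 \<and> W \<in> bounded_ops H2 K2 \<and>
    \<comment> \<open>(1)\<close>
    (\<forall>\<kappa>\<in>carrier K1. kadj H1 K1 V \<kappa> = hadj H1 K1 V \<kappa>) \<and>
    (\<forall>a. \<forall>\<xi>\<in>carrier H1. \<pi> (\<alpha> a) (V \<xi>) = fsym K1 (\<pi> a (V (fsym H1 \<xi>)))) \<and>
    coisometry H2 K2 W \<and>
    (\<forall>\<kappa>\<in>carrier K2. kadj H2 K2 W \<kappa> = hadj H2 K2 W \<kappa>) \<and>
    \<comment> \<open>(2)\<close>
    (\<forall>a. \<forall>\<xi>\<in>carrier H1. \<phi> a \<xi> = kadj H1 K1 V (\<pi> a (V \<xi>))) \<and>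
    \<comment> \<open>(3)\<close>
    (\<forall>x. \<forall>\<xi>\<in>carrier H1. \<Phi> x \<xi> = kadj H2 K2 W (\<pi>X x (V \<xi>))) \<and>
    \<comment> \<open>(4)\<close>
    (\<forall>t\<in>carrier G. (\<forall>\<kappa>\<in>carrier K1. kadj K1 K1 (v t) \<kappa> = hadj K1 K1 (v t) \<kappa>) \<and>
       (\<forall>\<kappa>\<in>carrier K2. kadj K2 K2 (v' t) \<kappa> = hadj K2 K2 (v' t) \<kappa>)) \<and>
    \<comment> \<open>(5)\<close>
    (\<forall>t\<in>carrier G. (\<forall>\<xi>\<in>carrier H1. V (u t \<xi>) = v t (V \<xi>)) \<and>
       (\<forall>\<xi>\<in>carrier H2. W (u' t \<xi>) = v' t (W \<xi>)))"
proof -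
  interpret phi_map_dilation \<alpha> H1 \<phi> act ip H2 \<Phi>
    using assms by (intro phi_map_dilation.intro alpha_cp_map.intro phi_map_dilation_axioms.intro)
  interpret covariant_dilation \<alpha> H1 \<phi> act ip H2 \<Phi> G T \<eta> u u'
    using assms phi_map_dilation_axioms
    by (intro covariant_dilation.intro covariant_dilation_axioms.intro)
      (auto simp: locally_compact_group_def)
  let ?W = "\<lambda>y :: 'h2. y"
  note H2h = H2.hilbert_space_axioms
  have W: "coisometry H2 H2 ?W" "?W \<in> bounded_ops H2 H2"
    "\<And>y. y \<in> carrier H2 \<Longrightarrow> kadj H2 H2 ?W y = hadj H2 H2 ?W y"
    "\<And>y. y \<in> carrier H2 \<Longrightarrow> kadj H2 H2 ?W y = y"
    using fsym_H2 by (auto simp: coisometry_def id_bounded_ops[OF H2h] hadj_id[OF H2h] kadj_def)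
  show ?thesis
  proof (rule exI[of _ R], rule exI[of _ H2], rule exI[of _ v], rule exI[of _ u'],
      rule exI[of _ \<pi>], rule exI[of _ \<pi>X], rule exI[of _ V], rule exI[of _ ?W], intro conjI)
    show "\<forall>a. \<forall>\<xi>\<in>carrier H1. \<phi> a \<xi> = kadj H1 R V (\<pi> a (V \<xi>))" by (simp add: phi_dilation)
    show "\<forall>a. \<forall>\<xi>\<in>carrier H1. \<pi> (\<alpha> a) (V \<xi>) = fsym R (\<pi> a (V (fsym H1 \<xi>)))"
      using pi_alpha_V by blast
  qed (use krein_R krein_H2 pseudo_unitary_v u' krein_rep_pi module_rep_piX covariant_piX V_ops W
      in \<open>simp_all add: kadj_V kadj_v(1) kadj_H2 u'_ops V_u piX_V\<close>)
qed

end
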